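(* Let $Z\in\mathbb{S}^n$ be diagonal, with the eigenvalue and block notation of the context. Then for all $H,W\in\mathbb{S}^n$ the blocks of $M:=\Pi_+''(Z;H,W)$ are as follows (blocks involving the index $0$ are absent if $0$ is not an eigenvalue of $Z$). For $a,b\in\Omega_+$: $$M_{ab}=W_{ab}+2\sum_{c\in\Omega_-}\frac{-\lambda_c}{(\lambda_c-\lambda_a)(\lambda_c-\lambda_b)}H_{ac}H_{cb}.$$ For $a\in\Omega_+$: $$M_{a0}=W_{a0}+2\sum_{c\in\Omega_-}\frac{1}{\lambda_a-\lambda_c}H_{ac}H_{c0}-\frac{2}{\lambda_a}H_{a0}\Pi_+(-H_{00}).$$ For $a\in\Omega_+$, $b\in\Omega_-$: $$M_{ab}=\frac{\lambda_a}{\lambda_a-\lambda_b}W_{ab}+2\sum_{c\in\Omega_+}\frac{-\lambda_b}{(\lambda_b-\lambda_a)(\lambda_b-\lambda_c)}H_{ac}H_{cb}+\frac{2}{\lambda_a-\lambda_b}H_{a0}H_{0b}+2\sum_{c\in\Omega_-}\frac{\lambda_a}{(\lambda_a-\lambda_b)(\lambda_a-\lambda_c)}H_{ac}H_{cb}.$$ The zero block: $$M_{00}=2\sum_{c\in\Omega_+}\frac{1}{\lambda_c}H_{0c}H_{c0}+\Pi_+'(H_{00};V_0),\qquad V_0:=W_{00}-2\sum_{l\in\Omega_+\cup\Omega_-}\frac{1}{\lambda_l}H_{0l}H_{l0}.$$ For $b\in\Omega_-$: $$M_{0b}=2\sum_{c\in\Omega_+}\frac{1}{\lambda_c-\lambda_b}H_{0c}H_{cb}+\frac{2}{-\lambda_b}\Pi_+(H_{00})H_{0b}.$$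 For $a,b\in\Omega_-$: $$M_{ab}=2\sum_{c\in\Omega_+}\frac{\lambda_c}{(\lambda_c-\lambda_a)(\lambda_c-\lambda_b)}H_{ac}H_{cb}.$$ The remaining blocks follow by symmetry: $M_{lk}=M_{kl}^{\mathsf T}$. Moreover, for a general (not necessarily diagonal) $Z\in\mathbb{S}^n$ and any orthogonal $Q$ such that $\tilde Z:=Q^{\mathsf T}ZQ$ is diagonal, $$\Pi_+''(Z;H,W)=Q\,\Pi_+''(\tilde Z;Q^{\mathsf T}HQ,Q^{\mathsf T}WQ)\,Q^{\mathsf T}.$$
   Context: $\mathbb{S}^k$ is the space of real symmetric $k\times k$ matrices with the Frobenius inner product, and $\Pi_+$ denotes the orthogonal projection onto the positive semidefinite cone (in whichever $\mathbb{S}^k$ is relevant). Directional derivatives: $$\Pi_+'(Z;H):=\lim_{t\downarrow0}\frac{\Pi_+(Z+tH)-\Pi_+(Z)}{t},\qquad \Pi_+''(Z;H,W):=\lim_{t\downarrow0}\frac{\Pi_+(Z+tH+\tfrac{t^2}{2}W)-\Pi_+(Z)-t\Pi_+'(Z;H)}{t^2/2}.$$ For diagonal $Z$: - $\{\lambda_a\}_{a\in\Omega_+}$ are the distinct positive eigenvalues of $Z$ and $\{\lambda_b\}_{b\in\Omega_-}$ the distinct negative ones; - if $0$ is an eigenvalue it is indexed by $0$ with $\lambda_0=0$; - $\alpha_k:=\{i:Z_{ii}=\lambda_k\}$. For a matrix $M$, $M_{kl}$ denotes the submatrix with rows in $\alpha_k$ and columns in $\alpha_l$. Thus $H_{00}\in\mathbb{S}^{|\alpha_0|}$,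 and $\Pi_+(H_{00})$, $\Pi_+(-H_{00})$, $\Pi_+'(H_{00};V_0)$ are taken in $\mathbb{S}^{|\alpha_0|}$. *)

theory Defs
  imports "HOL-Analysis.Analysis"
begin

text \<open>Real n x n matrices are modelled as real^'n^'n (Frobenius norm = the library norm).
  A symmetric matrix supported on I x I (zero outside) models an element of S^{|I|};
  so S^n corresponds to I = UNIV.\<close>

definition sym_mat :: "real^'n^'n \<Rightarrow> bool" where
  "sym_mat A \<longleftrightarrow> transpose A = A"

definition diag_mat :: "real^'n^'n \<Rightarrow> bool" where
  "diag_mat A \<longleftrightarrow> (\<forall>i j. i \<noteq> j \<longrightarrow> A $ i $ j = 0)"

definition psd_on :: "'n set \<Rightarrow> (real^'n^'n) set" where
  "psd_on I = {A. (\<forall>i j. (i \<notin> I \<or> j \<notin> I) \<longrightarrow> A $ i $ j = 0) \<and> transpose A = A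
                  \<and> (\<forall>x. 0 \<le> x \<bullet> (A *v x))}"

definition proj_psd_on :: "'n set \<Rightarrow> real^'n^'n \<Rightarrow> real^'n^'n" where
  "proj_psd_on I A = closest_point (psd_on I) A"

abbreviation proj_psd :: "real^'n^'n \<Rightarrow> real^'n^'n" where
  "proj_psd \<equiv> proj_psd_on UNIV"

definition dd1_on :: "'n set \<Rightarrow> real^'n^'n \<Rightarrow> real^'n^'n \<Rightarrow> real^'n^'n" where
  "dd1_on I Z H = Lim (at_right 0) (\<lambda>t. (proj_psd_on I (Z + t *\<^sub>R H) - proj_psd_on I Z) /\<^sub>R t)"

definition dd2_quot :: "real^'n^'n \<Rightarrow> real^'n^'n \<Rightarrow> real^'n^'n \<Rightarrow> real \<Rightarrow> real^'n^'n" where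
  "dd2_quot Z H W t =
     (proj_psd (Z + t *\<^sub>R H + (t\<^sup>2 / 2) *\<^sub>R W) - proj_psd Z - t *\<^sub>R dd1_on UNIV Z H) /\<^sub>R (t\<^sup>2 / 2)"

definition dd2 :: "real^'n^'n \<Rightarrow> real^'n^'n \<Rightarrow> real^'n^'n \<Rightarrow> real^'n^'n" where
  "dd2 Z H W = Lim (at_right 0) (dd2_quot Z H W)"

text \<open>Block M_{kl}: rows in I, columns in J, embedded (zero elsewhere).
  Products of blocks are then ordinary matrix products.\<close>
definition blk :: "real^'n^'n \<Rightarrow> 'n set \<Rightarrow> 'n set \<Rightarrow> real^'n^'n" where
  "blk M I J = (\<chi> i j. if i \<in> I \<and> j \<in> J then M $ i $ j else 0)"

text \<open>Eigenvalue index sets of a diagonal Z; blocks are indexed by the eigenvalue itself.\<close>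
definition alpha :: "real^'n^'n \<Rightarrow> real \<Rightarrow> 'n set" where
  "alpha Z l = {i. Z $ i $ i = l}"

definition Omega_pos :: "real^'n^'n \<Rightarrow> real set" where
  "Omega_pos Z = {Z $ i $ i | i. Z $ i $ i > 0}"

definition Omega_neg :: "real^'n^'n \<Rightarrow> real set" where
  "Omega_neg Z = {Z $ i $ i | i. Z $ i $ i < 0}"

end

theory Submission
  imports Defs
begin

text \<open>If \<open>P\<close> and \<open>N\<close> are positive semidefinite, then \<open>P\<close> differs from the projection of
  \<open>P - N\<close> by at most the square root of \<open>P \<bullet> N\<close>; no exact orthogonality of \<open>P\<close> and \<open>N\<close> is needed.
  For diagonal \<open>Z\<close> put \<open>X t = Z + t H + (t\<^sup>2 / 2) W\<close> and choose \<open>U t = 1 + t K + t\<^sup>2 L\<close>,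
  orthogonal up to \<open>O(t\<^sup>3)\<close>, so that \<open>X t = U t (D t) (U t)\<^sup>T + O(t\<^sup>3)\<close> with \<open>D t\<close> block diagonal with
  respect to the sign of the eigenvalues of \<open>Z\<close>. The positive and negative blocks of \<open>D t\<close> are
  definite for small \<open>t\<close>, and the zero block is \<open>t E t\<close> with \<open>E t = H\<^sub>0\<^sub>0 + (t / 2) V\<^sub>0\<close>. Splitting \<open>D t\<close>
  into its positive and negative parts thus gives the projection of \<open>X t\<close> up to \<open>o(t\<^sup>2)\<close>, and
  the second-order coefficient is read off entry by entry. Existence of the directional derivative
  at \<open>H\<^sub>0\<^sub>0\<close> follows from the first-order part of the same expansion after diagonalizing
  \<open>H\<^sub>0\<^sub>0\<close>.\<close>

subsection \<open>The spectral theorem for symmetric matrices\<close>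

lemma inner_matrix_vector_sym:
  fixes A :: "real^'n^'n"
  assumes "transpose A = A"
  shows "x \<bullet> (A *v y) = (A *v x) \<bullet> y"
  by (metis assms dot_lmul_matrix matrix_transpose_mul transpose_matrix_vector)

text \<open>The first-order condition at a maximum, in algebraic form: near 0 the linear term
  outweighs the quadratic one, and \<open>t\<close> may have either sign.\<close>

lemma quadratic_coeff_zero:
  fixes a b :: real
  assumes "\<And>t. a * t \<le> b * t\<^sup>2"
  shows "a = 0"
proof (rule ccontr)
  assume "a \<noteq> 0"
  \<comment> \<open>\<open>c\<close> only has to be positive and larger than \<open>b\<close>: at
    \<open>t = a / c\<close> the hypothesis reads a^2/c <= b a^2/c^2, and the right-hand side is
    smaller than a^2/c.\<close>
  define c where "c = \<bar>b\<bar> + 1"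
  have c: "c > 0" "b < c" by (auto simp: c_def)
  have "a * (a / c) \<le> b * (a / c)\<^sup>2" by (rule assms)
  also have "\<dots> < c * (a / c)\<^sup>2" using c \<open>a \<noteq> 0\<close> by (intro mult_strict_right_mono) auto
  finally show False using c by (simp add: power2_eq_square)
qed

text \<open>A maximizer \<open>v\<close> of the Rayleigh quotient on the compact unit sphere of
  \<open>S\<close> is an eigenvector: invariance keeps the residual
  \<open>A *v v - c *\<^sub>R v\<close> in \<open>S\<close>, so moving \<open>v\<close> along it is
  admissible.\<close>

lemma symmetric_eigenvector_in_subspace:
  fixes A :: "real^'n^'n"
  assumes sym: "transpose A = A" and S: "subspace S" and inv: "\<And>x. x \<in> S \<Longrightarrow> A *v x \<in> S"
    and ne: "S \<noteq> {0}"
  obtains v c where "v \<in> S" "norm v = 1" "A *v v = c *\<^sub>R v"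
proof -
  let ?K = "sphere 0 1 \<inter> S"
  have K: "compact ?K" using S by (simp add: closed_subspace compact_Int_closed)
  obtain w where w: "w \<in> S" "w \<noteq> 0" using ne subspace_0[OF S] by blast
  then have "w /\<^sub>R norm w \<in> ?K" using S by (simp add: subspace_scale)
  then have "?K \<noteq> {}" by blast
  moreover have "continuous_on ?K (\<lambda>x. x \<bullet> (A *v x))" by (intro continuous_intros)
  ultimately obtain v where v: "v \<in> ?K" and max: "\<And>x. x \<in> ?K \<Longrightarrow> x \<bullet> (A *v x) \<le> v \<bullet> (A *v v)"
    using continuous_attains_sup[OF K, of "\<lambda>x. x \<bullet> (A *v x)"] by blast
  define c where "c = v \<bullet> (A *v v)"
  have vv: "v \<bullet> v = 1" using v by (simp add: dot_square_norm)
  have bound: "x \<bullet> (A *v x) \<le> c * (x \<bullet> x)" if "x \<in> S" for x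
  proof (cases "x = 0")
    case False
    have "x /\<^sub>R norm x \<in> ?K" using that S False by (simp add: subspace_scale)
    from max[OF this] have "(x \<bullet> (A *v x)) / (norm x)\<^sup>2 \<le> c"
      by (simp add: c_def matrix_vector_mult_scaleR power2_eq_square divide_inverse mult_ac)
    then show ?thesis using False by (simp add: divide_le_eq dot_square_norm)
  qed auto
  \<comment> \<open>Along \<open>v + t *\<^sub>R u\<close> the first-order gain in
    \<open>bound\<close> is 2 (u . u) t, so maximality forces the residual to vanish.\<close>
  define u where "u = A *v v - c *\<^sub>R v"
  have u: "u \<in> S" unfolding u_def using v S inv by (auto intro!: subspace_diff subspace_scale)
  have "2 * (u \<bullet> u) * t \<le> (c * (u \<bullet> u) - u \<bullet> (A *v u)) * t\<^sup>2" for t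
  proof -
    have "v + t *\<^sub>R u \<in> S" using u v S by (auto intro!: subspace_add subspace_scale)
    from bound[OF this]
    have "c + 2 * t * (u \<bullet> (A *v v)) + t\<^sup>2 * (u \<bullet> (A *v u)) \<le> c * (1 + 2 * t * (u \<bullet> v) + t\<^sup>2 * (u \<bullet> u))"
      using inner_matrix_vector_sym[OF sym, of v u]
      by (simp add: matrix_vector_right_distrib matrix_vector_mult_scaleR inner_add vv
          flip: c_def) (simp add: inner_commute algebra_simps power2_eq_square)
    moreover have "u \<bullet> (A *v v) = u \<bullet> u + c * (u \<bullet> v)"
      by (metis add.commute diff_add_cancel inner_add_right inner_scaleR_right u_def)
    ultimately show ?thesis by (simp add: algebra_simps)
  qed
  then have "2 * (u \<bullet> u) = 0" by (rule quadratic_coeff_zero)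
  then have "A *v v = c *\<^sub>R v" by (simp add: u_def)
  then show thesis using that v by auto
qed

text \<open>Induction on the dimension of \<open>S\<close>: split off one unit eigenvector; its
  orthogonal complement \<open>T\<close> within \<open>S\<close> is again invariant, because
  \<open>A\<close> is symmetric.\<close>

lemma symmetric_orthonormal_eigenbasis:
  fixes A :: "real^'n^'n"
  assumes sym: "transpose A = A" and "subspace S" and "\<And>x. x \<in> S \<Longrightarrow> A *v x \<in> S"
  shows "\<exists>B \<subseteq> S. finite B \<and> card B = dim S \<and> pairwise orthogonal B \<and>
           (\<forall>v\<in>B. norm v = 1 \<and> (\<exists>c. A *v v = c *\<^sub>R v))"
  using assms(2,3)
proof (induction "dim S" arbitrary: S)
  case 0
  then show ?case by (intro exI[of _ "{}"]) auto
next
  case (Suc m)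
  then have "S \<noteq> {0}" by auto
  then obtain v c where v: "v \<in> S" "norm v = 1" "A *v v = c *\<^sub>R v"
    using symmetric_eigenvector_in_subspace[OF sym Suc.prems(1)] Suc.prems(2) by metis
  define T where "T = {y \<in> S. \<forall>x\<in>span {v}. orthogonal x y}"
  have T: "T = {y \<in> S. v \<bullet> y = 0}"
    unfolding T_def by (auto simp: span_singleton orthogonal_def)
  have "dim T + dim (span {v}) = dim S"
    unfolding T_def using v Suc.prems(1)
    by (intro dim_subspace_orthogonal_to_vectors) (auto simp: span_minimal)
  moreover have "v \<noteq> 0" using v by auto
  ultimately have "m = dim T" using Suc.hyps(2) by (simp add: dim_insert split: if_splits)
  moreover have "subspace T"
    using Suc.prems(1) unfolding T by (auto simp: subspace_def inner_add)
  moreover have "A *v x \<in> T" if "x \<in> T" for x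
    using that Suc.prems(2) v inner_matrix_vector_sym[OF sym, of v x] by (auto simp: T)
  ultimately obtain B where B: "B \<subseteq> T" "finite B" "card B = dim T" "pairwise orthogonal B"
      "\<forall>v\<in>B. norm v = 1 \<and> (\<exists>c. A *v v = c *\<^sub>R v)"
    using Suc.hyps(1) by blast
  have "v \<notin> B" using B(1) \<open>v \<noteq> 0\<close> by (auto simp: T)
  then show ?case
    using B v T \<open>m = dim T\<close> Suc.hyps(2)
    by (intro exI[of _ "insert v B"])
      (auto simp: pairwise_insert orthogonal_def inner_commute)
qed

lemma symmetric_orthogonally_diagonalizable:
  fixes A :: "real^'n^'n"
  assumes sym: "transpose A = A"
  obtains Q where "orthogonal_matrix Q" "diag_mat (transpose Q ** A ** Q)"
proof -
  obtain B where B: "finite B" "card B = CARD('n)" "pairwise orthogonal B"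
      "\<forall>v\<in>B. norm v = 1 \<and> (\<exists>c. A *v v = c *\<^sub>R v)"
    using symmetric_orthonormal_eigenbasis[OF sym, of UNIV] by auto
  then obtain f where f: "bij_betw f (UNIV :: 'n set) B"
    using finite_same_card_bij[of "UNIV :: 'n set" B] by auto
  define Q where "Q = (\<chi> i j. f j $ i)"
  have col: "column j Q = f j" for j by (simp add: Q_def column_def vec_eq_iff)
  have fB: "f j \<in> B" for j using f by (auto simp: bij_betw_def)
  have orth: "f i \<bullet> f j = 0" if "i \<noteq> j" for i j
    using that f B(3) fB[of i] fB[of j] by (auto simp: pairwise_def orthogonal_def bij_betw_def inj_def)
  have "orthogonal_matrix Q"
    unfolding orthogonal_matrix_orthonormal_columns
    using B(4) fB orth by (auto simp: col orthogonal_def)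
  moreover have "(transpose Q ** A ** Q) $ i $ j = f i \<bullet> (A *v f j)" for i j
  proof -
    have "(transpose Q ** (A ** Q)) $ i $ j = column i Q \<bullet> column j (A ** Q)"
      by (simp add: matrix_matrix_mult_def column_def transpose_def inner_vec_def)
    also have "column j (A ** Q) = A *v f j"
      by (simp add: matrix_matrix_mult_def column_def matrix_vector_mult_def Q_def)
    finally show ?thesis by (simp add: col matrix_mul_assoc)
  qed
  then have "diag_mat (transpose Q ** A ** Q)"
    unfolding diag_mat_def using B(4) fB orth by (metis inner_scaleR_right mult_zero_right)
  ultimately show thesis by (rule that)
qed

subsection \<open>The projection onto the positive semidefinite cone\<close>

lemma bounded_bilinear_matrix_mult:
  "bounded_bilinear ((**) :: real^'m^'n \<Rightarrow> real^'p^'m \<Rightarrow> real^'p^'n)"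
proof -
  have "bilinear ((**) :: real^'m^'n \<Rightarrow> real^'p^'m \<Rightarrow> real^'p^'n)"
    unfolding bilinear_def
    by (auto intro!: linearI simp: vec_eq_iff matrix_matrix_mult_def sum.distrib sum_distrib_left
      algebra_simps)
  then show ?thesis using bilinear_conv_bounded_bilinear by blast
qed

lemmas tendsto_matrix_mult [tendsto_intros] = bounded_bilinear.tendsto [OF bounded_bilinear_matrix_mult]
lemmas matrix_mult_bilinear_simps =
  bounded_bilinear.add_left [OF bounded_bilinear_matrix_mult]
  bounded_bilinear.add_right [OF bounded_bilinear_matrix_mult]
  bounded_bilinear.diff_left [OF bounded_bilinear_matrix_mult]
  bounded_bilinear.diff_right [OF bounded_bilinear_matrix_mult]
  bounded_bilinear.minus_left [OF bounded_bilinear_matrix_mult]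
  bounded_bilinear.minus_right [OF bounded_bilinear_matrix_mult]
  bounded_bilinear.zero_left [OF bounded_bilinear_matrix_mult]
  bounded_bilinear.zero_right [OF bounded_bilinear_matrix_mult]
  bounded_bilinear.scaleR_left [OF bounded_bilinear_matrix_mult]
  bounded_bilinear.scaleR_right [OF bounded_bilinear_matrix_mult]

lemma bounded_linear_transpose: "bounded_linear (transpose :: real^'m^'n \<Rightarrow> real^'n^'m)"
  by (intro linear_conv_bounded_linear[THEN iffD1] linearI) (auto simp: transpose_def vec_eq_iff)

lemmas tendsto_transpose [tendsto_intros] = bounded_linear.tendsto [OF bounded_linear_transpose]
lemmas transpose_linear_simps =
  linear_add [OF bounded_linear.linear [OF bounded_linear_transpose]]
  linear_diff [OF bounded_linear.linear [OF bounded_linear_transpose]]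
  linear_neg [OF bounded_linear.linear [OF bounded_linear_transpose]]
  linear_0 [OF bounded_linear.linear [OF bounded_linear_transpose]]
  linear_scale [OF bounded_linear.linear [OF bounded_linear_transpose]]

lemma inner_matrix: "A \<bullet> B = (\<Sum>i\<in>UNIV. \<Sum>j\<in>UNIV. A $ i $ j * B $ i $ j)" for A B :: "real^'m^'n"
  by (simp add: inner_vec_def)

lemma inner_transpose: "transpose A \<bullet> transpose B = A \<bullet> B" for A B :: "real^'m^'n"
  unfolding inner_matrix transpose_def by (simp, rule sum.swap)

lemma inner_matrix_mult_left: "(A ** B) \<bullet> C = B \<bullet> (transpose A ** C)"
  for A :: "real^'m^'n" and B :: "real^'p^'m"
proof -
  have "(A ** B) \<bullet> C = (\<Sum>i\<in>UNIV. \<Sum>j\<in>UNIV. \<Sum>k\<in>UNIV. A $ i $ k * B $ k $ j * C $ i $ j)"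
    by (simp add: inner_matrix matrix_matrix_mult_def sum_distrib_right)
  also have "\<dots> = (\<Sum>j\<in>UNIV. \<Sum>i\<in>UNIV. \<Sum>k\<in>UNIV. A $ i $ k * B $ k $ j * C $ i $ j)"
    by (rule sum.swap)
  also have "\<dots> = (\<Sum>j\<in>UNIV. \<Sum>k\<in>UNIV. \<Sum>i\<in>UNIV. A $ i $ k * B $ k $ j * C $ i $ j)"
    by (intro sum.cong refl sum.swap)
  also have "\<dots> = (\<Sum>k\<in>UNIV. \<Sum>j\<in>UNIV. \<Sum>i\<in>UNIV. A $ i $ k * B $ k $ j * C $ i $ j)"
    by (rule sum.swap)
  also have "\<dots> = B \<bullet> (transpose A ** C)"
    by (simp add: inner_matrix matrix_matrix_mult_def transpose_def sum_distrib_left mult_ac)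
  finally show ?thesis .
qed

lemma inner_matrix_mult_right: "(A ** B) \<bullet> C = A \<bullet> (C ** transpose B)"
  for A :: "real^'m^'n" and B :: "real^'p^'m"
proof -
  have "(A ** B) \<bullet> C = (transpose B ** transpose A) \<bullet> transpose C"
    by (simp add: inner_transpose flip: matrix_transpose_mul)
  also have "\<dots> = transpose A \<bullet> transpose (C ** transpose B)"
    by (simp add: inner_matrix_mult_left matrix_transpose_mul)
  finally show ?thesis by (simp add: inner_transpose)
qed

section \<open>The positive semidefinite cone\<close>

lemma psd_on_UNIV: "A \<in> psd_on UNIV \<longleftrightarrow> transpose A = A \<and> (\<forall>x. 0 \<le> x \<bullet> (A *v x))"
  by (simp add: psd_on_def)

lemma psd_on_UNIV_transpose: "A \<in> psd_on UNIV \<Longrightarrow> transpose A = A"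
  by (simp add: psd_on_UNIV)

lemma psd_congruence:
  assumes "A \<in> psd_on UNIV"
  shows "U ** A ** transpose U \<in> psd_on UNIV"
  unfolding psd_on_UNIV
proof safe
  show "transpose (U ** A ** transpose U) = U ** A ** transpose U"
    using assms by (simp add: psd_on_UNIV matrix_transpose_mul matrix_mul_assoc)
  fix x
  have "x \<bullet> (U ** A ** transpose U *v x) = (transpose U *v x) \<bullet> (A *v (transpose U *v x))"
    by (simp add: dot_lmul_matrix transpose_matrix_vector flip: matrix_vector_mul_assoc)
  then show "0 \<le> x \<bullet> (U ** A ** transpose U *v x)"
    using assms by (simp add: psd_on_UNIV)
qed

lemma psd_diagonal_nonneg:
  assumes "A \<in> psd_on UNIV"
  shows "A $ i $ i \<ge> 0"
proof -
  have "axis i 1 \<bullet> (A *v axis i 1) = A $ i $ i"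
    by (simp add: matrix_vector_mult_basis inner_axis' column_def)
  then show ?thesis using assms unfolding psd_on_UNIV by metis
qed

lemma diag_mat_psd:
  assumes "diag_mat D" "\<And>i. 0 \<le> D $ i $ i"
  shows "D \<in> psd_on UNIV"
  unfolding psd_on_UNIV
proof safe
  show "transpose D = D" unfolding vec_eq_iff
  proof safe
    fix i j
    show "transpose D $ i $ j = D $ i $ j"
      using assms(1) by (cases "i = j") (auto simp: diag_mat_def transpose_def)
  qed
  fix x
  have "(D *v x) $ i = D $ i $ i * x $ i" for i
  proof -
    have "(D *v x) $ i = (\<Sum>j\<in>UNIV. if j = i then D $ i $ i * x $ i else 0)"
      unfolding matrix_vector_mult_def vec_lambda_beta
      by (rule sum.cong) (use assms(1) in \<open>auto simp: diag_mat_def\<close>)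
    then show ?thesis by simp
  qed
  then have "x \<bullet> (D *v x) = (\<Sum>i\<in>UNIV. D $ i $ i * (x $ i)\<^sup>2)"
    by (simp add: inner_vec_def power2_eq_square mult_ac)
  then show "0 \<le> x \<bullet> (D *v x)" using assms(2) by (simp add: sum_nonneg)
qed

lemma inner_diag_mat: "diag_mat D \<Longrightarrow> A \<bullet> D = (\<Sum>i\<in>UNIV. A $ i $ i * D $ i $ i)"
proof -
  assume "diag_mat D"
  then have "(\<Sum>j\<in>UNIV. A $ i $ j * D $ i $ j) = (\<Sum>j\<in>UNIV. if j = i then A $ i $ i * D $ i $ i else 0)" for i
    by (intro sum.cong) (auto simp: diag_mat_def)
  then show ?thesis by (simp add: inner_matrix)
qed

lemma orthogonal_conj_cancel:
  fixes Q :: "real^'n^'n"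
  assumes "orthogonal_matrix Q"
  shows "Q ** (transpose Q ** A ** Q) ** transpose Q = A"
    and "transpose Q ** (Q ** A ** transpose Q) ** Q = A"
proof -
  have "Q ** (transpose Q ** A ** Q) ** transpose Q = (Q ** transpose Q) ** A ** (Q ** transpose Q)"
    by (simp add: matrix_mul_assoc)
  then show "Q ** (transpose Q ** A ** Q) ** transpose Q = A"
    using assms by (simp add: orthogonal_matrix_def)
  have "transpose Q ** (Q ** A ** transpose Q) ** Q = (transpose Q ** Q) ** A ** (transpose Q ** Q)"
    by (simp add: matrix_mul_assoc)
  then show "transpose Q ** (Q ** A ** transpose Q) ** Q = A"
    using assms by (simp add: orthogonal_matrix_def)
qed

text \<open>Half of the self-duality of the cone. In an eigenbasis of \<open>B\<close> the inner
  product becomes a sum of products of diagonal entries of two positive semidefinite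
  matrices.\<close>

lemma psd_inner_nonneg:
  fixes A B :: "real^'n^'n"
  assumes A: "A \<in> psd_on UNIV" and B: "B \<in> psd_on UNIV"
  shows "0 \<le> A \<bullet> B"
proof -
  obtain Q where Q: "orthogonal_matrix Q" "diag_mat (transpose Q ** B ** Q)"
    using symmetric_orthogonally_diagonalizable[OF psd_on_UNIV_transpose[OF B]] .
  define D where "D = transpose Q ** B ** Q"
  have "A \<bullet> B = A \<bullet> (Q ** D ** transpose Q)"
    using Q(1) by (simp add: D_def orthogonal_conj_cancel)
  also have "\<dots> = (Q ** (D ** transpose Q)) \<bullet> A"
    by (simp only: inner_commute matrix_mul_assoc)
  also have "\<dots> = (D ** transpose Q) \<bullet> (transpose Q ** A)"
    by (rule inner_matrix_mult_left)
  also have "\<dots> = D \<bullet> (transpose Q ** A ** Q)"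
    by (simp only: inner_matrix_mult_right transpose_transpose)
  also have "\<dots> = (transpose Q ** A ** Q) \<bullet> D"
    by (rule inner_commute)
  also have "\<dots> = (\<Sum>i\<in>UNIV. (transpose Q ** A ** Q) $ i $ i * D $ i $ i)"
    using Q(2) by (simp add: D_def inner_diag_mat)
  also have "\<dots> \<ge> 0"
    using psd_congruence[OF A, of "transpose Q"] psd_congruence[OF B, of "transpose Q"]
    by (auto simp: D_def intro!: sum_nonneg mult_nonneg_nonneg psd_diagonal_nonneg)
  finally show ?thesis .
qed

lemma psd_on_zero: "0 \<in> psd_on I"
  by (simp add: psd_on_def transpose_linear_simps)

lemma psd_on_add: "A \<in> psd_on I \<Longrightarrow> B \<in> psd_on I \<Longrightarrow> A + B \<in> psd_on I"
  by (simp add: psd_on_def transpose_linear_simps matrix_vector_mult_add_rdistrib inner_add_right)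

lemma psd_on_scaleR: "A \<in> psd_on I \<Longrightarrow> 0 \<le> c \<Longrightarrow> c *\<^sub>R A \<in> psd_on I"
  by (simp add: psd_on_def transpose_linear_simps flip: scaleR_matrix_vector_assoc)

lemma convex_psd_on: "convex (psd_on I)"
  by (intro convexI psd_on_add psd_on_scaleR)

lemma closed_psd_on: "closed (psd_on I :: (real^'n^'n) set)"
proof -
  have "bounded_linear (\<lambda>A :: real^'n^'n. A *v x)" for x
    by (intro linear_conv_bounded_linear[THEN iffD1] linearI)
      (simp_all add: matrix_vector_mult_add_rdistrib scaleR_matrix_vector_assoc)
  then have mv: "continuous_on UNIV (\<lambda>A :: real^'n^'n. A *v x)" for x
    by (rule linear_continuous_on)
  have "closed {A :: real^'n^'n. i \<notin> I \<or> j \<notin> I \<longrightarrow> A $ i $ j = 0}" for i j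
    by (cases "i \<notin> I \<or> j \<notin> I") (auto intro!: closed_Collect_eq continuous_intros)
  moreover have "closed {A :: real^'n^'n. transpose A = A}"
    by (intro closed_Collect_eq linear_continuous_on bounded_linear_transpose continuous_on_id)
  moreover have "closed {A :: real^'n^'n. 0 \<le> x \<bullet> (A *v x)}" for x
    by (intro closed_Collect_le continuous_intros mv)
  ultimately show ?thesis
    unfolding psd_on_def by (intro closed_Collect_conj closed_Collect_all)
qed

section \<open>The projection and complementary pairs of positive semidefinite matrices\<close>

lemma proj_psd_in: "proj_psd_on I A \<in> psd_on I"
  unfolding proj_psd_on_def using closed_psd_on psd_on_zero by (intro closest_point_in_set) auto

lemma proj_psd_nonexpansive: "norm (proj_psd_on I A - proj_psd_on I B) \<le> norm (A - B)"
  unfolding proj_psd_on_def using closest_point_lipschitz[OF convex_psd_on closed_psd_on] psd_on_zero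
  by (metis dist_norm empty_iff)

text \<open>With Y the projection, the variational inequality tested at \<open>P\<close> gives |P -
  Y|^2 <= N . (P - Y), and N . Y >= 0 by self-duality.\<close>

lemma proj_psd_approx:
  assumes P: "P \<in> psd_on UNIV" and N: "N \<in> psd_on UNIV"
  shows "(norm (proj_psd (P - N) - P))\<^sup>2 \<le> P \<bullet> N"
proof -
  let ?Y = "proj_psd (P - N)"
  have "(P - N - ?Y) \<bullet> (P - ?Y) \<le> 0"
    unfolding proj_psd_on_def using convex_psd_on closed_psd_on P by (rule closest_point_dot)
  moreover have "0 \<le> N \<bullet> ?Y" using N proj_psd_in by (rule psd_inner_nonneg)
  ultimately show ?thesis
    unfolding power2_norm_eq_inner by (simp add: algebra_simps inner_commute)
qed

text \<open>\<open>P \<bullet> N\<close> is the trace of \<open>P ** N\<close>, so the approximation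
  bound becomes 0. This is the sufficient direction of the Moreau decomposition.\<close>

lemma proj_psd_eqI:
  assumes "P \<in> psd_on UNIV" "N \<in> psd_on UNIV" "P ** N = 0"
  shows "proj_psd (P - N) = P"
proof -
  have "P \<bullet> N = mat 1 \<bullet> (P ** N)"
    using inner_matrix_mult_left[of P "mat 1" N] psd_on_UNIV_transpose[OF assms(1)] by simp
  then show ?thesis using proj_psd_approx[OF assms(1,2)] assms(3) by simp
qed

text \<open>Splitting the eigenvalues into positive and negative parts exhibits a complementary pair
  for \<open>A\<close>, and \<open>proj_psd_eqI\<close> identifies its first member as the
  projection.\<close>

lemma proj_psd_complement:
  fixes A :: "real^'n^'n"
  assumes "transpose A = A"
  shows "proj_psd A - A \<in> psd_on UNIV" "proj_psd A ** (proj_psd A - A) = 0"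
proof -
  obtain Q where Q: "orthogonal_matrix Q" and D: "diag_mat (transpose Q ** A ** Q)"
    using symmetric_orthogonally_diagonalizable[OF assms] .
  define d where "d i = (transpose Q ** A ** Q) $ i $ i" for i
  \<comment> \<open>\<open>E f\<close> is \<open>f\<close> applied to the diagonalized
    \<open>A\<close>; conjugating back by \<open>Q\<close> gives the functional calculus.\<close>
  define E where "E f = ((\<chi> i j. if i = j then f (d i) else 0) :: real^'n^'n)" for f :: "real \<Rightarrow> real"
  define P where "P = Q ** E (max 0) ** transpose Q"
  define N where "N = Q ** E (\<lambda>x. max 0 (- x)) ** transpose Q"
  have psd: "P \<in> psd_on UNIV" "N \<in> psd_on UNIV"
    unfolding P_def N_def by (intro psd_congruence diag_mat_psd; simp add: diag_mat_def E_def)+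
  have "(transpose Q ** A ** Q) $ i $ j = (E (max 0) - E (\<lambda>x. max 0 (- x))) $ i $ j" for i j
    using D by (cases "i = j") (auto simp: E_def d_def diag_mat_def max_def)
  then have "transpose Q ** A ** Q = E (max 0) - E (\<lambda>x. max 0 (- x))"
    by (simp add: vec_eq_iff)
  then have A: "A = P - N"
    using orthogonal_conj_cancel(1)[OF Q, of A] by (simp add: P_def N_def matrix_mult_bilinear_simps)
  have E0: "E (max 0) ** E (\<lambda>x. max 0 (- x)) = 0"
    unfolding vec_eq_iff matrix_matrix_mult_def vec_lambda_beta E_def
    by (intro allI) (auto intro!: sum.neutral)
  have "P ** N = Q ** (E (max 0) ** (transpose Q ** Q) ** E (\<lambda>x. max 0 (- x))) ** transpose Q"
    by (simp add: P_def N_def matrix_mul_assoc)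
  also have "\<dots> = 0"
    using Q E0 by (simp add: orthogonal_matrix_def matrix_mult_bilinear_simps)
  finally have PN: "P ** N = 0" .
  show "proj_psd A - A \<in> psd_on UNIV" "proj_psd A ** (proj_psd A - A) = 0"
    using proj_psd_eqI[OF psd PN] psd PN by (simp_all add: A)
qed

text \<open>Conjugation by \<open>Q\<close> carries the complementary pair of \<open>A\<close> to
  that of the conjugate matrix, since \<open>transpose Q ** Q\<close> cancels inside the
  product.\<close>

lemma proj_psd_orthogonal_conj:
  fixes Q :: "real^'n^'n"
  assumes A: "transpose A = A" and Q: "orthogonal_matrix Q"
  shows "proj_psd (Q ** A ** transpose Q) = Q ** proj_psd A ** transpose Q"
proof -
  let ?N = "proj_psd A - A"
  have "Q ** proj_psd A ** transpose Q ** (Q ** ?N ** transpose Q) =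
      Q ** (proj_psd A ** (transpose Q ** Q) ** ?N) ** transpose Q"
    by (simp only: matrix_mul_assoc)
  also have "\<dots> = 0"
    using Q proj_psd_complement[OF A]
    by (simp only: orthogonal_matrix_def matrix_mul_rid) (simp add: matrix_mult_bilinear_simps(7,8))
  finally have "proj_psd (Q ** proj_psd A ** transpose Q - Q ** ?N ** transpose Q) = Q ** proj_psd A ** transpose Q"
    using proj_psd_complement(1)[OF A] by (intro proj_psd_eqI psd_congruence proj_psd_in) auto
  moreover have "Q ** proj_psd A ** transpose Q - Q ** ?N ** transpose Q = Q ** A ** transpose Q"
    by (simp add: matrix_mult_bilinear_simps)
  ultimately show ?thesis by simp
qed

text \<open>Replacing \<open>A\<close> by \<open>- A\<close> exchanges the two members of the
  complementary pair. This is how Pi_+(- H_00) enters the block formulas.\<close>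

lemma proj_psd_uminus:
  assumes A: "transpose A = A"
  shows "proj_psd (- A) = proj_psd A - A"
proof -
  have "transpose (proj_psd A ** (proj_psd A - A)) = 0"
    using proj_psd_complement[OF A] by (simp add: transpose_linear_simps)
  then have "(proj_psd A - A) ** proj_psd A = 0"
    using proj_psd_complement(1)[OF A] proj_psd_in[of UNIV A]
    by (simp only: matrix_transpose_mul psd_on_UNIV)
  then have "proj_psd (proj_psd A - A - proj_psd A) = proj_psd A - A"
    using proj_psd_complement[OF A] by (intro proj_psd_eqI proj_psd_in) auto
  then show ?thesis by simp
qed

text \<open>Complementarity gives \<open>?P ** ?P = ?P ** A\<close>, whose diagonal entries outside
  \<open>I\<close> vanish; these are sums of squares over the rows of \<open>?P\<close>. So the
  minimizer over the larger cone already lies in the smaller one, and projections in S^{|I|} can be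
  computed in S^n.\<close>

lemma proj_psd_on_eq:
  fixes A :: "real^'n^'n"
  assumes A: "transpose A = A" and supp: "\<And>i j. i \<notin> I \<or> j \<notin> I \<Longrightarrow> A $ i $ j = 0"
  shows "proj_psd_on I A = proj_psd A"
proof -
  let ?P = "proj_psd A"
  have P: "transpose ?P = ?P" using proj_psd_in by (rule psd_on_UNIV_transpose)
  have symP: "?P $ i $ j = ?P $ j $ i" for i j
    using arg_cong[OF P, of "\<lambda>M. M $ j $ i"] by (simp only: transpose_def vec_lambda_beta)
  have row: "?P $ j $ i = 0" if "j \<notin> I" for i j
  proof -
    have "?P ** ?P = ?P ** A"
      using proj_psd_complement(2)[OF A] by (simp add: matrix_mult_bilinear_simps(4))
    moreover have "(?P ** A) $ j $ j = 0" using supp that by (simp add: matrix_matrix_mult_def)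
    ultimately have "(?P ** ?P) $ j $ j = 0" by simp
    then have "(\<Sum>k\<in>UNIV. (?P $ j $ k)\<^sup>2) = 0"
      by (simp add: matrix_matrix_mult_def power2_eq_square symP[of _ j])
    then show ?thesis by (simp add: sum_nonneg_eq_0_iff)
  qed
  then have "?P $ i $ j = 0" if "i \<notin> I \<or> j \<notin> I" for i j using that symP[of i j] by auto
  then have "?P \<in> psd_on I" using proj_psd_in[of UNIV A] by (simp add: psd_on_def)
  moreover have "psd_on I \<subseteq> psd_on UNIV" by (auto simp: psd_on_def)
  then have "\<forall>Y\<in>psd_on I. dist A ?P \<le> dist A Y"
    unfolding proj_psd_on_def using closest_point_le[OF closed_psd_on] by blast
  ultimately show ?thesis
    using closest_point_unique[OF convex_psd_on closed_psd_on, of ?P I A]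
    unfolding proj_psd_on_def by metis
qed

subsection \<open>Second-order expansions\<close>

text \<open>Peano form of a one-sided expansion: f t = a + t b + t^2 c + o(t^2) as t decreases to 0.
  The coefficient \<open>c\<close> is half of the second derivative in the normalization of
  \<open>dd2\<close>.\<close>

definition expand2 :: "(real \<Rightarrow> 'a::real_normed_vector) \<Rightarrow> 'a \<Rightarrow> 'a \<Rightarrow> 'a \<Rightarrow> bool" where
  "expand2 f a b c \<longleftrightarrow>
     ((\<lambda>t. (f t - a - t *\<^sub>R b - t\<^sup>2 *\<^sub>R c) /\<^sub>R t\<^sup>2) \<longlongrightarrow> 0) (at_right 0)"

lemma tendsto_id_at_right_0: "((\<lambda>t. t) \<longlongrightarrow> 0) (at_right (0::real))"
  by (rule tendsto_ident_at)

lemma eventually_at_right_0_pos: "eventually (\<lambda>t. 0 < t) (at_right (0::real))"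
  by (simp add: eventually_at_right_less)

lemma expand2_poly: "expand2 (\<lambda>t. a + t *\<^sub>R b + t\<^sup>2 *\<^sub>R c) a b c"
  by (simp add: expand2_def)

lemma expand2_mult:
  fixes a :: "real^'m^'n" and a' :: "real^'p^'m"
  assumes f: "expand2 f a b c" and g: "expand2 g a' b' c'"
  shows "expand2 (\<lambda>t. f t ** g t) (a ** a') (a ** b' + b ** a') (a ** c' + b ** b' + c ** a')"
proof -
  define r where "r = (\<lambda>t. (f t - a - t *\<^sub>R b - t\<^sup>2 *\<^sub>R c) /\<^sub>R t\<^sup>2)"
  define r' where "r' = (\<lambda>t. (g t - a' - t *\<^sub>R b' - t\<^sup>2 *\<^sub>R c') /\<^sub>R t\<^sup>2)"
  have lim: "(r \<longlongrightarrow> 0) (at_right 0)" "(r' \<longlongrightarrow> 0) (at_right 0)"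
    using f g by (simp_all add: expand2_def r_def r'_def)
  \<comment> \<open>The exact remainder of the product divided by t^2: each term carries a remainder
    \<open>r\<close> or \<open>r'\<close> or a further factor t.\<close>
  have "((\<lambda>t. a ** r' t + r t ** a' + t *\<^sub>R (b ** (c' + r' t) + (c + r t) ** b')
           + t\<^sup>2 *\<^sub>R ((c + r t) ** (c' + r' t))) \<longlongrightarrow>
         a ** 0 + 0 ** a' + 0 *\<^sub>R (b ** (c' + 0) + (c + 0) ** b') + 0\<^sup>2 *\<^sub>R ((c + 0) ** (c' + 0))) (at_right 0)"
    by (intro tendsto_intros lim tendsto_id_at_right_0)
  moreover have "eventually (\<lambda>t.
      a ** r' t + r t ** a' + t *\<^sub>R (b ** (c' + r' t) + (c + r t) ** b') + t\<^sup>2 *\<^sub>R ((c + r t) ** (c' + r' t)) =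
      (f t ** g t - a ** a' - t *\<^sub>R (a ** b' + b ** a') - t\<^sup>2 *\<^sub>R (a ** c' + b ** b' + c ** a')) /\<^sub>R t\<^sup>2) (at_right 0)"
    using eventually_at_right_0_pos
  proof eventually_elim
    case (elim t)
    have fg: "f t = a + t *\<^sub>R b + t\<^sup>2 *\<^sub>R (c + r t)" "g t = a' + t *\<^sub>R b' + t\<^sup>2 *\<^sub>R (c' + r' t)"
      using elim by (simp_all add: r_def r'_def algebra_simps)
    have "f t ** g t - a ** a' - t *\<^sub>R (a ** b' + b ** a') - t\<^sup>2 *\<^sub>R (a ** c' + b ** b' + c ** a')
      = t\<^sup>2 *\<^sub>R (a ** r' t + r t ** a' + t *\<^sub>R (b ** (c' + r' t) + (c + r t) ** b')
           + t\<^sup>2 *\<^sub>R ((c + r t) ** (c' + r' t)))"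
      unfolding fg by (simp add: matrix_mult_bilinear_simps algebra_simps power2_eq_square)
    then show ?case using elim by simp
  qed
  ultimately show ?thesis
    unfolding expand2_def by (auto simp: matrix_mult_bilinear_simps elim!: Lim_transform_eventually)
qed

lemma expand2_cong:
  assumes f: "expand2 f a b c" and fg: "((\<lambda>t. (g t - f t) /\<^sub>R t\<^sup>2) \<longlongrightarrow> 0) (at_right 0)"
  shows "expand2 g a b c"
  using tendsto_add[OF f[unfolded expand2_def] fg]
  by (simp add: expand2_def algebra_simps)

lemma expand2_diff:
  assumes "expand2 f a b c" "expand2 g a b c"
  shows "((\<lambda>t. (f t - g t) /\<^sub>R t\<^sup>2) \<longlongrightarrow> 0) (at_right 0)"
  using tendsto_diff[OF assms[unfolded expand2_def]]
  by (simp add: algebra_simps)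

text \<open>Row-wise Cauchy-Schwarz; the Frobenius norm thus dominates the operator norm.\<close>

lemma norm_matrix_vector_mult_le: "norm (A *v x) \<le> norm A * norm x" for A :: "real^'m^'n"
proof -
  have "norm (A *v x) = L2_set (\<lambda>i. \<bar>A $ i \<bullet> x\<bar>) UNIV"
    by (simp add: norm_vec_def matrix_vector_mul_component)
  also have "\<dots> \<le> L2_set (\<lambda>i. norm (A $ i) * norm x) UNIV"
    by (intro L2_set_mono Cauchy_Schwarz_ineq2) auto
  also have "\<dots> = norm A * norm x"
    by (simp add: norm_vec_def[of A] L2_set_left_distrib)
  finally show ?thesis .
qed

section \<open>Blocks and their positivity under perturbation\<close>

lemma blk_nth: "blk A I J $ i $ j = (if i \<in> I \<and> j \<in> J then A $ i $ j else 0)"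
  by (simp add: blk_def)

lemma transpose_nth: "transpose A $ i $ j = A $ j $ i"
  by (simp add: transpose_def)

lemma transpose_blk: "transpose (blk A I J) = blk (transpose A) J I"
  by (simp add: vec_eq_iff blk_def transpose_def)

lemma blk_linear_simps:
  fixes A B :: "real^'n^'n"
  shows "blk (A + B) I J = blk A I J + blk B I J"
    "blk (A - B) I J = blk A I J - blk B I J"
    "blk (- A) I J = - blk A I J"
    "blk (c *\<^sub>R A) I J = c *\<^sub>R blk A I J"
    "blk 0 I J = (0 :: real^'n^'n)"
  by (simp_all add: vec_eq_iff blk_def)

lemma bounded_linear_blk: "bounded_linear (\<lambda>A :: real^'n^'n. blk A I J)"
  by (intro linear_conv_bounded_linear[THEN iffD1] linearI) (simp_all add: blk_linear_simps)

lemmas tendsto_blk [tendsto_intros] = bounded_linear.tendsto [OF bounded_linear_blk]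

lemma blk_mult_disjoint:
  assumes "J \<inter> K = {}"
  shows "blk A I J ** blk B K L = (0 :: real^'n^'n)"
  using assms by (auto simp: vec_eq_iff blk_def matrix_matrix_mult_def intro!: sum.neutral)

lemma blk_self: "(\<And>i j. i \<notin> I \<or> j \<notin> J \<Longrightarrow> A $ i $ j = 0) \<Longrightarrow> blk A I J = A"
  by (auto simp: vec_eq_iff blk_def)

lemma psd_on_blk: "A \<in> psd_on I \<Longrightarrow> blk A I I = A"
  by (intro blk_self) (auto simp: psd_on_def)

text \<open>On vectors supported in \<open>I\<close> the quadratic form of \<open>Z\<close> is at
  least \<open>norm (A - Z)\<close> times the squared length, which outweighs the form of the
  perturbation \<open>A - Z\<close>.\<close>

lemma psd_on_blkI:
  fixes A Z :: "real^'n^'n"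
  assumes sym: "transpose A = A" and Z: "diag_mat Z" "\<And>i. i \<in> I \<Longrightarrow> norm (A - Z) \<le> Z $ i $ i"
  shows "blk A I I \<in> psd_on UNIV"
  unfolding psd_on_UNIV
proof safe
  show "transpose (blk A I I) = blk A I I" using sym by (simp add: transpose_blk)
  fix x :: "real^'n"
  \<comment> \<open>Cutting \<open>x\<close> down to \<open>I\<close> turns the form of the block at
    \<open>x\<close> into the form of \<open>A\<close> at \<open>y\<close>.\<close>
  define y where "y = (\<chi> i. if i \<in> I then x $ i else 0)"
  have "x \<bullet> (blk A I I *v x) = (\<Sum>i\<in>UNIV. \<Sum>j\<in>UNIV. x $ i * (blk A I I $ i $ j * x $ j))"
    by (simp add: inner_vec_def matrix_vector_mult_def sum_distrib_left)
  also have "\<dots> = (\<Sum>i\<in>UNIV. \<Sum>j\<in>UNIV. y $ i * (A $ i $ j * y $ j))"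
    by (intro sum.cong refl) (simp add: y_def blk_def)
  also have "\<dots> = y \<bullet> (A *v y)"
    by (simp add: inner_vec_def matrix_vector_mult_def sum_distrib_left)
  also have "\<dots> = y \<bullet> (Z *v y) + y \<bullet> ((A - Z) *v y)"
    by (simp add: matrix_vector_mult_diff_rdistrib inner_diff_right)
  finally have eq: "x \<bullet> (blk A I I *v x) = y \<bullet> (Z *v y) + y \<bullet> ((A - Z) *v y)" .
  have "(\<Sum>j\<in>UNIV. y $ i * (Z $ i $ j * y $ j)) = (\<Sum>j\<in>UNIV. if j = i then Z $ i $ i * (y $ i)\<^sup>2 else 0)" for i
    by (rule sum.cong) (use Z(1) in \<open>auto simp: diag_mat_def power2_eq_square\<close>)
  then have "y \<bullet> (Z *v y) = (\<Sum>i\<in>UNIV. Z $ i $ i * (y $ i)\<^sup>2)"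
    by (simp add: inner_vec_def matrix_vector_mult_def sum_distrib_left)
  also have "\<dots> \<ge> (\<Sum>i\<in>UNIV. norm (A - Z) * (y $ i)\<^sup>2)"
    using Z(2) by (intro sum_mono) (auto simp: y_def intro!: mult_right_mono)
  also have "(\<Sum>i\<in>UNIV. norm (A - Z) * (y $ i)\<^sup>2) = norm (A - Z) * (y \<bullet> y)"
    by (simp add: inner_vec_def power2_eq_square sum_distrib_left)
  finally have "norm (A - Z) * (y \<bullet> y) \<le> y \<bullet> (Z *v y)" .
  moreover have "\<bar>y \<bullet> ((A - Z) *v y)\<bar> \<le> norm y * (norm (A - Z) * norm y)"
    by (rule order_trans[OF Cauchy_Schwarz_ineq2]) (intro mult_left_mono norm_matrix_vector_mult_le norm_ge_zero)
  moreover have "norm y * (norm (A - Z) * norm y) = norm (A - Z) * (y \<bullet> y)"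
    by (simp add: dot_square_norm power2_eq_square)
  ultimately show "0 \<le> x \<bullet> (blk A I I *v x)" unfolding eq by linarith
qed

lemma eventually_psd_on_blk:
  fixes Z :: "real^'n^'n"
  assumes lim: "(f \<longlongrightarrow> Z) F" and sym: "\<And>t. transpose (f t) = f t"
    and Z: "diag_mat Z" "\<And>i. i \<in> I \<Longrightarrow> 0 < Z $ i $ i"
  shows "eventually (\<lambda>t. blk (f t) I I \<in> psd_on UNIV) F"
proof -
  have "eventually (\<lambda>t. \<forall>i\<in>I. norm (f t - Z) < Z $ i $ i) F"
    using tendstoD[OF lim Z(2)] by (intro eventually_ball_finite) (auto simp: dist_norm)
  then show ?thesis
    by eventually_elim (auto intro!: psd_on_blkI[OF sym Z(1)] intro: less_imp_le)
qed

text \<open>Expanding A . ((1 + G) B (1 + G)), every term with at most one factor \<open>G\<close>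
  vanishes because \<open>A ** B\<close> and \<open>B ** A\<close> are zero. The result is quadratic
  in \<open>G\<close>, so for bounded \<open>A\<close> and \<open>B\<close> an orthogonality defect
  o(t^2) yields an inner product o(t^4).\<close>

lemma inner_nearly_orthogonal_conj:
  fixes A B U :: "real^'n^'n"
  assumes sym: "transpose A = A" "transpose B = B" and AB: "A ** B = 0"
    and G: "transpose U ** U = mat 1 + G"
  shows "(U ** A ** transpose U) \<bullet> (U ** B ** transpose U) = A \<bullet> (G ** B ** G)"
proof -
  have BA: "B ** A = 0"
    using arg_cong[OF AB, of transpose] sym by (simp add: matrix_transpose_mul transpose_linear_simps)
  have 1: "A \<bullet> (C ** B) = 0" for C
    using inner_matrix_mult_right[of C B A] sym AB by (simp add: inner_commute)
  have 2: "A \<bullet> (B ** C) = 0" for C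
    using inner_matrix_mult_left[of B C A] sym BA by (simp add: inner_commute)
  have "(U ** A ** transpose U) \<bullet> (U ** B ** transpose U) = (U ** A) \<bullet> (U ** B ** (transpose U ** U))"
    by (simp only: inner_matrix_mult_right transpose_transpose matrix_mul_assoc)
  also have "\<dots> = A \<bullet> ((transpose U ** U) ** B ** (transpose U ** U))"
    by (simp only: inner_matrix_mult_left matrix_mul_assoc)
  also have "\<dots> = A \<bullet> (G ** B ** G)"
    unfolding G using 1 2 1[of "mat 1"]
    by (simp add: matrix_mult_bilinear_simps inner_add_right)
  finally show ?thesis .
qed

subsection \<open>Perturbation of a diagonal matrix\<close>

lemma diag_mat_transpose: "diag_mat Z \<Longrightarrow> transpose Z = Z"
  unfolding vec_eq_iff
proof safe
  fix i j
  assume "diag_mat Z"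
  then show "transpose Z $ i $ j = Z $ i $ j"
    by (cases "i = j") (auto simp: diag_mat_def transpose_def)
qed

lemma diag_mat_mult_nth:
  fixes Z A :: "real^'n^'n"
  assumes Z: "diag_mat Z"
  shows "(Z ** A) $ i $ j = Z $ i $ i * A $ i $ j" "(A ** Z) $ i $ j = A $ i $ j * Z $ j $ j"
proof -
  have "(\<Sum>k\<in>UNIV. Z $ i $ k * A $ k $ j) = (\<Sum>k\<in>UNIV. if k = i then Z $ i $ i * A $ i $ j else 0)"
    by (rule sum.cong) (use Z in \<open>auto simp: diag_mat_def\<close>)
  then show "(Z ** A) $ i $ j = Z $ i $ i * A $ i $ j" by (simp add: matrix_matrix_mult_def)
  have "(\<Sum>k\<in>UNIV. A $ i $ k * Z $ k $ j) = (\<Sum>k\<in>UNIV. if k = j then A $ i $ j * Z $ j $ j else 0)"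
    by (rule sum.cong) (use Z in \<open>auto simp: diag_mat_def\<close>)
  then show "(A ** Z) $ i $ j = A $ i $ j * Z $ j $ j" by (simp add: matrix_matrix_mult_def)
qed

locale diag_perturbation =
  fixes Z H W :: "real^'n^'n"
  assumes diagZ: "diag_mat Z" and symH: "transpose H = H" and symW: "transpose W = W"
begin

abbreviation z :: "'n \<Rightarrow> real" where "z i \<equiv> Z $ i $ i"
abbreviation Ip :: "'n set" where "Ip \<equiv> {i. z i > 0}"
abbreviation I0 :: "'n set" where "I0 \<equiv> {i. z i = 0}"
abbreviation In :: "'n set" where "In \<equiv> {i. z i < 0}"

text \<open>Indices are grouped by the sign of the eigenvalue and not by the eigenvalue itself, so
  every denominator in \<open>cross\<close> joins eigenvalues of different sign and is
  nonzero.\<close>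

definition same :: "real^'n^'n \<Rightarrow> real^'n^'n" where
  "same A = (\<chi> i j. if sgn (z i) = sgn (z j) then A $ i $ j else 0)"

definition cross :: "real^'n^'n \<Rightarrow> real^'n^'n" where
  "cross A = (\<chi> i j. if sgn (z i) = sgn (z j) then 0 else A $ i $ j / (z j - z i))"

text \<open>\<open>K\<close> and \<open>cross B\<close> are skew-symmetric and solve \<open>K Z - Z K = H - same H\<close> and
  \<open>(cross B) Z - Z (cross B) = B - same B\<close>, which removes the first- and second-order entries between
  eigenvalues of different sign; the term \<open>K\<^sup>2 / 2\<close> in \<open>L\<close> makes \<open>U t\<close> orthogonal to second order.\<close>
definition K where "K = cross H"
definition B where
  "B = (1/2) *\<^sub>R W - (K ** same H - same H ** K) + K ** Z ** K - (1/2) *\<^sub>R (K ** K ** Z + Z ** K ** K)"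
definition L where "L = (1/2) *\<^sub>R (K ** K) + cross B"
definition L' where "L' = (1/2) *\<^sub>R (K ** K) - cross B"

definition U where "U t = mat 1 + t *\<^sub>R K + t\<^sup>2 *\<^sub>R L"
definition D where "D t = Z + t *\<^sub>R same H + t\<^sup>2 *\<^sub>R same B"
definition E where "E t = blk H I0 I0 + t *\<^sub>R blk B I0 I0"
text \<open>Positive and negative part of \<open>D t\<close> for small t > 0: the definite blocks
  are taken whole, and the zero block \<open>t *\<^sub>R E t\<close> is split by projecting
  \<open>E t\<close>.\<close>

definition Dp where "Dp t = blk (D t) Ip Ip + t *\<^sub>R proj_psd (E t)"
definition Dn where "Dn t = t *\<^sub>R (proj_psd (E t) - E t) - blk (D t) In In"
definition X where "X t = Z + t *\<^sub>R H + (t\<^sup>2/2) *\<^sub>R W"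

lemma symZ: "transpose Z = Z" by (rule diag_mat_transpose[OF diagZ])

text \<open>The commutator with the diagonal \<open>Z\<close> multiplies entry (i, j) by
  \<open>z j - z i\<close>, which cancels the denominator in \<open>cross\<close>.\<close>

lemma same_cross: "same A + cross A ** Z - Z ** cross A = A"
  unfolding vec_eq_iff
proof safe
  fix i j
  show "(same A + cross A ** Z - Z ** cross A) $ i $ j = A $ i $ j"
  proof (cases "sgn (z i) = sgn (z j)")
    case False
    then have "z j - z i \<noteq> 0" by auto
    then have "A $ i $ j / (z j - z i) * (z j - z i) = A $ i $ j" by simp
    then have "A $ i $ j / (z j - z i) * z j - z i * (A $ i $ j / (z j - z i)) = A $ i $ j"
      by (simp only: right_diff_distrib mult.commute[of "z i"])
    with False show ?thesis by (simp add: same_def cross_def diag_mat_mult_nth[OF diagZ])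
  qed (simp add: same_def cross_def diag_mat_mult_nth[OF diagZ])
qed

lemma transpose_same: "transpose (same A) = same (transpose A)"
  by (auto simp: vec_eq_iff same_def transpose_def)

lemma transpose_cross: "transpose A = A \<Longrightarrow> transpose (cross A) = - cross A"
proof -
  assume "transpose A = A"
  then have "A $ j $ i = A $ i $ j" for i j by (metis transpose_nth)
  then show ?thesis
    unfolding vec_eq_iff
    by (auto simp: cross_def transpose_def minus_divide_right)
qed

lemma transpose_K: "transpose K = - K"
  unfolding K_def using symH by (rule transpose_cross)

lemma transpose_B: "transpose B = B"
  unfolding B_def
  by (simp add: transpose_linear_simps matrix_transpose_mul transpose_same transpose_K symH symW symZ
     matrix_mult_bilinear_simps matrix_mul_assoc)

lemma transpose_L: "transpose L = L'"
  by (simp add: L_def L'_def transpose_linear_simps matrix_transpose_mul transpose_K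
    transpose_cross[OF transpose_B] matrix_mult_bilinear_simps)

lemma transpose_U: "transpose (U t) = mat 1 + t *\<^sub>R (- K) + t\<^sup>2 *\<^sub>R L'"
  by (simp add: U_def transpose_linear_simps transpose_K transpose_L)

lemma transpose_D: "transpose (D t) = D t"
  by (simp add: D_def transpose_linear_simps transpose_same symH transpose_B symZ)

lemma transpose_E: "transpose (E t) = E t"
  by (simp add: E_def transpose_linear_simps transpose_blk symH transpose_B)

lemma expand2_U: "expand2 U (mat 1) K L"
  using expand2_poly[of "mat 1" K L] by (simp add: U_def[abs_def])

lemma expand2_transpose_U: "expand2 (\<lambda>t. transpose (U t)) (mat 1) (- K) L'"
  unfolding transpose_U by (rule expand2_poly)

text \<open>The order-t terms \<open>K\<close> and \<open>- K\<close> cancel, and at order t^2 the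
  sum \<open>L + L'\<close> equals \<open>K ** K\<close>, the negative of the remaining product
  \<open>(- K) ** K\<close>.\<close>

lemma expand2_UtU: "expand2 (\<lambda>t. transpose (U t) ** U t) (mat 1) 0 0"
  using expand2_mult[OF expand2_transpose_U expand2_U]
  by (simp add: L_def L'_def matrix_mult_bilinear_simps flip: scaleR_left_distrib)

lemma expand2_conj:
  assumes "expand2 f a b c"
  shows "expand2 (\<lambda>t. U t ** f t ** transpose (U t)) a (b + K ** a - a ** K)
           (c + K ** b - b ** K - K ** a ** K + L ** a + a ** L')"
  using expand2_mult[OF expand2_mult[OF expand2_U assms] expand2_transpose_U]
  by (simp add: matrix_mult_bilinear_simps algebra_simps)

text \<open>By \<open>same_cross\<close>, \<open>same B\<close> and the commutator of
  \<open>cross B\<close> with \<open>Z\<close> add up to \<open>B\<close>, and \<open>B\<close> is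
  W/2 minus exactly the second-order terms left over from \<open>K\<close>.\<close>

lemma expand2_UDU: "expand2 (\<lambda>t. U t ** D t ** transpose (U t)) Z H ((1/2) *\<^sub>R W)"
proof -
  have "same B + K ** same H - same H ** K - K ** Z ** K + L ** Z + Z ** L' =
      (same B + cross B ** Z - Z ** cross B) + K ** same H - same H ** K - K ** Z ** K
        + (1/2) *\<^sub>R (K ** K ** Z + Z ** K ** K)"
    by (simp add: L_def L'_def matrix_mult_bilinear_simps matrix_mul_assoc algebra_simps)
  also have "\<dots> = (1/2) *\<^sub>R W"
    unfolding same_cross by (simp add: B_def)
  finally show ?thesis
    using expand2_conj[OF expand2_poly[of Z "same H" "same B"]] same_cross[of H]
    by (simp add: D_def[abs_def] K_def)
qed

lemma X_UDU: "((\<lambda>t. (X t - U t ** D t ** transpose (U t)) /\<^sub>R t\<^sup>2) \<longlongrightarrow> 0) (at_right 0)"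
  using expand2_diff[OF expand2_poly[of Z H "(1/2) *\<^sub>R W"] expand2_UDU]
  by (simp add: X_def)

lemma blk_D: "blk (D t) I0 I0 = t *\<^sub>R E t"
proof -
  have "Z $ i $ j = 0" if "z i = 0" for i j
    using diagZ that by (cases "i = j") (auto simp: diag_mat_def)
  then show ?thesis
    by (auto simp: vec_eq_iff blk_def D_def E_def same_def algebra_simps power2_eq_square)
qed

lemma Dp_Dn: "Dp t - Dn t = D t"
proof -
  have "D t $ i $ j = 0" if "sgn (z i) \<noteq> sgn (z j)" for i j
    using diagZ that by (cases "i = j") (auto simp: D_def same_def diag_mat_def)
  then have "D t = blk (D t) Ip Ip + blk (D t) I0 I0 + blk (D t) In In"
    by (auto simp: vec_eq_iff blk_def sgn_if split: if_splits)
  then show ?thesis by (simp add: Dp_def Dn_def blk_D algebra_simps)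
qed

lemma proj_E: "proj_psd (E t) = proj_psd_on I0 (E t)"
  by (rule proj_psd_on_eq[symmetric, OF transpose_E]) (auto simp: E_def blk_def)

lemma proj_E_blk: "proj_psd (E t) = blk (proj_psd (E t)) I0 I0"
  using proj_psd_in[of I0 "E t"] by (simp add: proj_E psd_on_blk)

lemma E_blk: "E t = blk (E t) I0 I0"
  by (auto simp: E_def blk_def vec_eq_iff)

text \<open>\<open>p\<close> and \<open>q\<close> are complementary inside the zero block; all other
  products join blocks with disjoint indices.\<close>

lemma Dp_mult_Dn: "Dp t ** Dn t = 0"
proof -
  define p q where "p = proj_psd (E t)" and "q = proj_psd (E t) - E t"
  have pq: "p = blk p I0 I0" "q = blk q I0 I0"
    using proj_E_blk[of t] E_blk[of t] by (simp_all add: p_def q_def blk_linear_simps)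
  have "p ** q = 0" unfolding p_def q_def by (rule proj_psd_complement(2)[OF transpose_E])
  moreover have "blk (D t) Ip Ip ** q = 0" "blk (D t) Ip Ip ** blk (D t) In In = 0"
    by (subst pq(2), rule blk_mult_disjoint, auto) (rule blk_mult_disjoint, auto)
  moreover have "p ** blk (D t) In In = 0"
    by (subst pq(1), rule blk_mult_disjoint, auto)
  moreover have "Dp t = blk (D t) Ip Ip + t *\<^sub>R p" "Dn t = t *\<^sub>R q - blk (D t) In In"
    by (simp_all add: Dp_def Dn_def p_def q_def)
  ultimately show ?thesis
    by (simp add: matrix_mult_bilinear_simps)
qed

lemma tendsto_D: "(D \<longlongrightarrow> Z) (at_right 0)"
  unfolding D_def[abs_def] by (rule tendsto_eq_intros tendsto_id_at_right_0 refl | simp)+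

lemma tendsto_E: "(E \<longlongrightarrow> blk H I0 I0) (at_right 0)"
  unfolding E_def[abs_def] by (rule tendsto_eq_intros tendsto_id_at_right_0 refl | simp)+

lemma tendsto_U: "(U \<longlongrightarrow> mat 1) (at_right 0)"
  unfolding U_def[abs_def] by (rule tendsto_eq_intros tendsto_id_at_right_0 refl | simp)+

lemma tendsto_proj_E: "((\<lambda>t. proj_psd (E t)) \<longlongrightarrow> proj_psd (blk H I0 I0)) (at_right 0)"
proof (rule LIM_zero_cancel, rule Lim_null_comparison)
  show "eventually (\<lambda>t. norm (proj_psd (E t) - proj_psd (blk H I0 I0)) \<le> norm (E t - blk H I0 I0)) (at_right 0)"
    by (simp add: proj_psd_nonexpansive)
  show "((\<lambda>t. norm (E t - blk H I0 I0)) \<longlongrightarrow> 0) (at_right 0)"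
    using tendsto_E by (simp add: tendsto_norm_zero LIM_zero)
qed

lemma tendsto_Dp: "(Dp \<longlongrightarrow> blk Z Ip Ip) (at_right 0)"
  unfolding Dp_def[abs_def]
  by (rule tendsto_eq_intros tendsto_id_at_right_0 tendsto_D tendsto_proj_E refl | simp)+

lemma tendsto_Dn: "(Dn \<longlongrightarrow> - blk Z In In) (at_right 0)"
  unfolding Dn_def[abs_def]
  by (rule tendsto_eq_intros tendsto_id_at_right_0 tendsto_D tendsto_proj_E tendsto_E refl | simp)+

lemma transpose_Dp: "transpose (Dp t) = Dp t"
  using psd_on_UNIV_transpose[OF proj_psd_in, of "E t"]
  by (simp add: Dp_def transpose_linear_simps transpose_blk transpose_D)

lemma transpose_Dn: "transpose (Dn t) = Dn t"
  using psd_on_UNIV_transpose[OF proj_psd_in, of "E t"]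
  by (simp add: Dn_def transpose_linear_simps transpose_blk transpose_D transpose_E)

lemma psd_Dp: "eventually (\<lambda>t. Dp t \<in> psd_on UNIV) (at_right 0)"
  using eventually_psd_on_blk[OF tendsto_D transpose_D diagZ, of Ip, simplified] eventually_at_right_0_pos
  by eventually_elim (auto simp: Dp_def intro!: psd_on_add psd_on_scaleR proj_psd_in)

lemma psd_Dn: "eventually (\<lambda>t. Dn t \<in> psd_on UNIV) (at_right 0)"
proof -
  have "eventually (\<lambda>t. blk (- D t) In In \<in> psd_on UNIV) (at_right 0)"
    using tendsto_minus[OF tendsto_D]
    by (rule eventually_psd_on_blk) (use diagZ in \<open>auto simp: transpose_linear_simps transpose_D diag_mat_def\<close>)
  then show ?thesis using eventually_at_right_0_pos
  proof eventually_elim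
    case (elim t)
    have "t *\<^sub>R (proj_psd (E t) - E t) + blk (- D t) In In \<in> psd_on UNIV"
      using elim by (intro psd_on_add psd_on_scaleR proj_psd_complement(1)[OF transpose_E]) auto
    then show ?case by (simp add: Dn_def blk_linear_simps)
  qed
qed

text \<open>For small t, conjugating by \<open>U t\<close> gives positive semidefinite
  \<open>P t\<close> and \<open>N t\<close> whose difference is \<open>X t\<close> up to o(t^2).
  Their inner product is o(t^4) by \<open>inner_nearly_orthogonal_conj\<close>, so
  \<open>proj_psd_approx\<close> bounds the error of \<open>P t\<close> by o(t^2), and
  nonexpansiveness passes from \<open>P t - N t\<close> to \<open>X t\<close>.\<close>

lemma proj_X_approx:
  "((\<lambda>t. (proj_psd (X t) - U t ** Dp t ** transpose (U t)) /\<^sub>R t\<^sup>2) \<longlongrightarrow> 0) (at_right 0)"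
proof -
  define P where "P t = U t ** Dp t ** transpose (U t)" for t
  define N where "N t = U t ** Dn t ** transpose (U t)" for t
  define G where "G t = transpose (U t) ** U t - mat 1" for t
  have PN: "P t - N t = U t ** D t ** transpose (U t)" for t
    by (simp add: P_def N_def Dp_Dn flip: matrix_mult_bilinear_simps)
  have G: "((\<lambda>t. G t /\<^sub>R t\<^sup>2) \<longlongrightarrow> 0) (at_right 0)"
    using expand2_UtU by (simp add: expand2_def G_def)
  \<comment> \<open>Each of the two defects \<open>G t\<close> absorbs one factor t^-2; this is the
    scaled upper bound for the squared error.\<close>
  have "((\<lambda>t. Dp t \<bullet> ((G t /\<^sub>R t\<^sup>2) ** Dn t ** (G t /\<^sub>R t\<^sup>2))) \<longlongrightarrow>
      blk Z Ip Ip \<bullet> (0 ** (- blk Z In In) ** 0)) (at_right 0)"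
    by (intro tendsto_intros G tendsto_Dp tendsto_Dn)
  then have lim: "((\<lambda>t. Dp t \<bullet> ((G t /\<^sub>R t\<^sup>2) ** Dn t ** (G t /\<^sub>R t\<^sup>2))) \<longlongrightarrow> 0) (at_right 0)"
    by (simp add: matrix_mult_bilinear_simps)
  have "((\<lambda>t. (norm ((proj_psd (P t - N t) - P t) /\<^sub>R t\<^sup>2))\<^sup>2) \<longlongrightarrow> 0) (at_right 0)"
  proof (rule tendsto_sandwich[OF _ _ tendsto_const lim])
    show "eventually (\<lambda>t. (norm ((proj_psd (P t - N t) - P t) /\<^sub>R t\<^sup>2))\<^sup>2 \<le>
        Dp t \<bullet> ((G t /\<^sub>R t\<^sup>2) ** Dn t ** (G t /\<^sub>R t\<^sup>2))) (at_right 0)"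
      using psd_Dp psd_Dn
    proof eventually_elim
      case (elim t)
      have "(norm (proj_psd (P t - N t) - P t))\<^sup>2 \<le> P t \<bullet> N t"
        using elim unfolding P_def N_def by (intro proj_psd_approx psd_congruence)
      also have "\<dots> = Dp t \<bullet> (G t ** Dn t ** G t)"
        unfolding P_def N_def
        by (rule inner_nearly_orthogonal_conj[OF transpose_Dp transpose_Dn Dp_mult_Dn]) (simp add: G_def)
      finally have "(norm (proj_psd (P t - N t) - P t))\<^sup>2 * (inverse (t\<^sup>2))\<^sup>2 \<le>
          Dp t \<bullet> (G t ** Dn t ** G t) * (inverse (t\<^sup>2))\<^sup>2"
        by (rule mult_right_mono) simp
      then show ?case
        by (simp add: matrix_mult_bilinear_simps power_mult_distrib power2_eq_square mult_ac)
    qed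
  qed auto
  then have "((\<lambda>t. norm ((proj_psd (P t - N t) - P t) /\<^sub>R t\<^sup>2)) \<longlongrightarrow> 0) (at_right 0)"
    by (rule power_tendsto_0_iff[THEN iffD1, rotated]) simp
  then have 1: "((\<lambda>t. (proj_psd (P t - N t) - P t) /\<^sub>R t\<^sup>2) \<longlongrightarrow> 0) (at_right 0)"
    by (rule tendsto_norm_zero_cancel)
  have 2: "((\<lambda>t. (proj_psd (X t) - proj_psd (P t - N t)) /\<^sub>R t\<^sup>2) \<longlongrightarrow> 0) (at_right 0)"
  proof (rule Lim_null_comparison)
    show "eventually (\<lambda>t. norm ((proj_psd (X t) - proj_psd (P t - N t)) /\<^sub>R t\<^sup>2) \<le>
        norm ((X t - U t ** D t ** transpose (U t)) /\<^sub>R t\<^sup>2)) (at_right 0)"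
      by (intro always_eventually allI)
        (simp add: PN[symmetric] mult_left_mono proj_psd_nonexpansive)
    show "((\<lambda>t. norm ((X t - U t ** D t ** transpose (U t)) /\<^sub>R t\<^sup>2)) \<longlongrightarrow> 0) (at_right 0)"
      using X_UDU by (rule tendsto_norm_zero)
  qed
  show ?thesis using tendsto_add[OF 2 1] by (simp add: P_def flip: scaleR_right_distrib)
qed

section \<open>Expansions of the projection along the curve \<open>X\<close>\<close>

definition D1p where "D1p = blk H Ip Ip + proj_psd (blk H I0 I0)"

lemma blk_D_pos: "blk (D t) Ip Ip = blk Z Ip Ip + t *\<^sub>R blk H Ip Ip + t\<^sup>2 *\<^sub>R blk B Ip Ip"
  by (auto simp: vec_eq_iff blk_def D_def same_def)

lemma proj_Z: "proj_psd Z = blk Z Ip Ip"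
proof -
  have "proj_psd (blk Z Ip Ip - blk (- Z) In In) = blk Z Ip Ip"
    by (intro proj_psd_eqI blk_mult_disjoint diag_mat_psd)
      (use diagZ in \<open>auto simp: diag_mat_def blk_def\<close>)
  moreover have "blk Z Ip Ip - blk (- Z) In In = Z"
    unfolding vec_eq_iff
  proof safe
    fix i j
    show "(blk Z Ip Ip - blk (- Z) In In) $ i $ j = Z $ i $ j"
      using diagZ by (cases "i = j") (auto simp: blk_def diag_mat_def)
  qed
  ultimately show ?thesis by simp
qed

text \<open>\<open>D1p\<close> is the order-t coefficient of \<open>Dp t\<close>, and the commutator
  comes from \<open>U t\<close>. Since the projection inside \<open>Dp t\<close> carries a factor t,
  its continuity suffices, so directional derivatives can afterwards be obtained from this lemma
  without circularity.\<close>

lemma has_dd1_X: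
  "((\<lambda>t. (proj_psd (X t) - proj_psd Z) /\<^sub>R t) \<longlongrightarrow> D1p + K ** blk Z Ip Ip - blk Z Ip Ip ** K) (at_right 0)"
proof -
  define r where "r t = (proj_psd (X t) - U t ** Dp t ** transpose (U t)) /\<^sub>R t\<^sup>2" for t
  have r: "(r \<longlongrightarrow> 0) (at_right 0)" using proj_X_approx by (simp add: r_def[abs_def])
  \<comment> \<open>\<open>F\<close>, \<open>V\<close> and \<open>V'\<close> are the difference
    quotients of \<open>Dp\<close>, \<open>U\<close> and the transpose of \<open>U\<close> at
    0.\<close>
  define F where "F t = blk H Ip Ip + t *\<^sub>R blk B Ip Ip + proj_psd (E t)" for t
  define V where "V t = K + t *\<^sub>R L" for t
  define V' where "V' t = - K + t *\<^sub>R L'" for t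
  let ?P = "blk Z Ip Ip"
  have "(F \<longlongrightarrow> D1p) (at_right 0)" unfolding F_def[abs_def] D1p_def
    by (rule tendsto_eq_intros tendsto_id_at_right_0 tendsto_proj_E refl | simp)+
  moreover have "(V \<longlongrightarrow> K) (at_right 0)" unfolding V_def[abs_def]
    by (rule tendsto_eq_intros tendsto_id_at_right_0 refl | simp)+
  moreover have "(V' \<longlongrightarrow> - K) (at_right 0)" unfolding V'_def[abs_def]
    by (rule tendsto_eq_intros tendsto_id_at_right_0 refl | simp)+
  moreover have "((\<lambda>t. transpose (U t)) \<longlongrightarrow> mat 1) (at_right 0)"
    using tendsto_transpose[OF tendsto_U] by simp
  ultimately have "((\<lambda>t. t *\<^sub>R r t + (V t ** Dp t ** transpose (U t) + F t ** transpose (U t) + ?P ** V' t)) \<longlongrightarrow>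
      0 *\<^sub>R 0 + (K ** ?P ** mat 1 + D1p ** mat 1 + ?P ** (- K))) (at_right 0)"
    by (intro tendsto_intros r tendsto_Dp tendsto_id_at_right_0)
  moreover have "eventually (\<lambda>t. t *\<^sub>R r t + (V t ** Dp t ** transpose (U t) + F t ** transpose (U t) + ?P ** V' t)
      = (proj_psd (X t) - proj_psd Z) /\<^sub>R t) (at_right 0)"
    using eventually_at_right_0_pos
  proof eventually_elim
    case (elim t)
    have U: "U t = mat 1 + t *\<^sub>R V t"
      by (simp add: U_def V_def algebra_simps power2_eq_square)
    have U': "transpose (U t) = mat 1 + t *\<^sub>R V' t"
      unfolding transpose_U by (simp add: V'_def algebra_simps power2_eq_square)
    have Dp: "Dp t = ?P + t *\<^sub>R F t"
      by (simp add: Dp_def F_def blk_D_pos algebra_simps power2_eq_square)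
    \<comment> \<open>Telescoping: the three factors are replaced by their limits one after another,
      from left to right.\<close>
    have "U t ** Dp t ** transpose (U t) - ?P =
       t *\<^sub>R (V t ** Dp t ** transpose (U t) + F t ** transpose (U t) + ?P ** V' t)"
      by (subst U, subst (1) Dp, subst (2) U')
        (simp add: Dp U' matrix_mult_bilinear_simps algebra_simps)
    moreover have "proj_psd (X t) = t\<^sup>2 *\<^sub>R r t + U t ** Dp t ** transpose (U t)"
      using elim by (simp add: r_def)
    ultimately have "proj_psd (X t) - proj_psd Z = t\<^sup>2 *\<^sub>R r t +
       t *\<^sub>R (V t ** Dp t ** transpose (U t) + F t ** transpose (U t) + ?P ** V' t)"
      by (simp only: proj_Z add_diff_eq[symmetric])
    also have "\<dots> = t *\<^sub>R (t *\<^sub>R r t + (V t ** Dp t ** transpose (U t) + F t ** transpose (U t) + ?P ** V' t))"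
      by (simp add: power2_eq_square scaleR_right_distrib)
    finally show ?case using elim by simp
  qed
  ultimately show ?thesis
    by (auto simp: matrix_mult_bilinear_simps algebra_simps elim!: Lim_transform_eventually)
qed

text \<open>In \<open>Dp t\<close> the projection of \<open>E t\<close> is multiplied by t, so its
  first-order coefficient \<open>T\<close> enters at order t^2; the rest is
  \<open>expand2_conj\<close>.\<close>

lemma expand2_proj_X:
  assumes T: "((\<lambda>t. (proj_psd (E t) - proj_psd (blk H I0 I0)) /\<^sub>R t) \<longlongrightarrow> T) (at_right 0)"
  shows "expand2 (\<lambda>t. proj_psd (X t)) (blk Z Ip Ip) (D1p + K ** blk Z Ip Ip - blk Z Ip Ip ** K)
    (blk B Ip Ip + T + K ** D1p - D1p ** K - K ** blk Z Ip Ip ** K + L ** blk Z Ip Ip + blk Z Ip Ip ** L')"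
proof (rule expand2_cong[OF expand2_conj proj_X_approx])
  have "((\<lambda>t. (proj_psd (E t) - proj_psd (blk H I0 I0)) /\<^sub>R t - T) \<longlongrightarrow> 0) (at_right 0)"
    using T by (rule LIM_zero)
  moreover have "eventually (\<lambda>t. (proj_psd (E t) - proj_psd (blk H I0 I0)) /\<^sub>R t - T =
      (Dp t - blk Z Ip Ip - t *\<^sub>R D1p - t\<^sup>2 *\<^sub>R (blk B Ip Ip + T)) /\<^sub>R t\<^sup>2) (at_right 0)"
    using eventually_at_right_0_pos
  proof eventually_elim
    case (elim t)
    have "Dp t - blk Z Ip Ip - t *\<^sub>R D1p - t\<^sup>2 *\<^sub>R (blk B Ip Ip + T) =
        t\<^sup>2 *\<^sub>R ((proj_psd (E t) - proj_psd (blk H I0 I0)) /\<^sub>R t - T)"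
      using elim by (simp add: Dp_def blk_D_pos D1p_def algebra_simps power2_eq_square)
    then show ?case using elim by simp
  qed
  ultimately show "expand2 Dp (blk Z Ip Ip) D1p (blk B Ip Ip + T)"
    unfolding expand2_def by (rule Lim_transform_eventually)
qed

end

section \<open>Existence of directional derivatives at symmetric matrices\<close>

lemma has_dd1_diag:
  fixes Z H :: "real^'n^'n"
  assumes "diag_mat Z" "transpose H = H"
  shows "\<exists>M. ((\<lambda>t. (proj_psd (Z + t *\<^sub>R H) - proj_psd Z) /\<^sub>R t) \<longlongrightarrow> M) (at_right 0)"
proof -
  \<comment> \<open>With \<open>W = 0\<close> the curve \<open>X\<close> is the straight line
    through \<open>Z\<close> in direction \<open>H\<close>.\<close>
  interpret diag_perturbation Z H 0
    by unfold_locales (use assms in \<open>simp_all add: transpose_linear_simps\<close>)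
  show ?thesis using has_dd1_X by (auto simp: X_def)
qed

text \<open>Diagonalizing \<open>A\<close> and using orthogonal equivariance reduces to
  \<open>has_dd1_diag\<close>. The general case serves the zero block of \<open>H\<close>, which is
  an arbitrary symmetric matrix.\<close>

lemma has_dd1:
  fixes A B :: "real^'n^'n"
  assumes A: "transpose A = A" and B: "transpose B = B"
  shows "\<exists>M. ((\<lambda>t. (proj_psd (A + t *\<^sub>R B) - proj_psd A) /\<^sub>R t) \<longlongrightarrow> M) (at_right 0)"
proof -
  obtain Q where Q: "orthogonal_matrix Q" "diag_mat (transpose Q ** A ** Q)"
    using symmetric_orthogonally_diagonalizable[OF A] .
  define A' B' where "A' = transpose Q ** A ** Q" and "B' = transpose Q ** B ** Q"
  have sym: "transpose A' = A'" "transpose B' = B'"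
    by (simp_all add: A'_def B'_def matrix_transpose_mul A B matrix_mul_assoc)
  have AB: "A = Q ** A' ** transpose Q" "B = Q ** B' ** transpose Q"
    by (simp_all add: A'_def B'_def orthogonal_conj_cancel[OF Q(1)])
  obtain M where M: "((\<lambda>t. (proj_psd (A' + t *\<^sub>R B') - proj_psd A') /\<^sub>R t) \<longlongrightarrow> M) (at_right 0)"
    using has_dd1_diag[OF Q(2) sym(2)] by (auto simp: A'_def)
  have "((\<lambda>t. Q ** ((proj_psd (A' + t *\<^sub>R B') - proj_psd A') /\<^sub>R t) ** transpose Q) \<longlongrightarrow> Q ** M ** transpose Q) (at_right 0)"
    by (intro tendsto_intros M)
  moreover have "Q ** ((proj_psd (A' + t *\<^sub>R B') - proj_psd A') /\<^sub>R t) ** transpose Q =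
      (proj_psd (A + t *\<^sub>R B) - proj_psd A) /\<^sub>R t" for t
  proof -
    have "A + t *\<^sub>R B = Q ** (A' + t *\<^sub>R B') ** transpose Q"
      by (simp add: AB matrix_mult_bilinear_simps)
    then have 1: "proj_psd (A + t *\<^sub>R B) = Q ** proj_psd (A' + t *\<^sub>R B') ** transpose Q"
      using proj_psd_orthogonal_conj[OF _ Q(1), of "A' + t *\<^sub>R B'"] sym by (simp add: transpose_linear_simps)
    have 2: "proj_psd A = Q ** proj_psd A' ** transpose Q"
      unfolding AB(1) using sym(1) Q(1) by (rule proj_psd_orthogonal_conj)
    show ?thesis unfolding 1 2 by (simp add: matrix_mult_bilinear_simps)
  qed
  ultimately show ?thesis by auto
qed

text \<open>\<open>dd1_on\<close> is a \<open>Lim\<close>, so it is informative only once the limit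
  exists; existence comes from \<open>has_dd1\<close> after \<open>proj_psd_on I\<close> is replaced
  by \<open>proj_psd\<close>. Symmetry and support then pass to the limit by uniqueness of
  limits.\<close>

lemma dd1_on_tendsto:
  fixes A B :: "real^'n^'n"
  assumes A: "transpose A = A" "\<And>i j. i \<notin> I \<or> j \<notin> I \<Longrightarrow> A $ i $ j = 0"
    and B: "transpose B = B" "\<And>i j. i \<notin> I \<or> j \<notin> I \<Longrightarrow> B $ i $ j = 0"
  shows "((\<lambda>t. (proj_psd (A + t *\<^sub>R B) - proj_psd A) /\<^sub>R t) \<longlongrightarrow> dd1_on I A B) (at_right 0)"
    and "transpose (dd1_on I A B) = dd1_on I A B"
    and "blk (dd1_on I A B) I I = dd1_on I A B"
proof -
  obtain M where M: "((\<lambda>t. (proj_psd (A + t *\<^sub>R B) - proj_psd A) /\<^sub>R t) \<longlongrightarrow> M) (at_right 0)"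
    using has_dd1[OF A(1) B(1)] by blast
  have sym: "transpose (A + t *\<^sub>R B) = A + t *\<^sub>R B" for t
    using A B by (simp add: transpose_linear_simps)
  have on: "proj_psd_on I (A + t *\<^sub>R B) = proj_psd (A + t *\<^sub>R B)" for t
    using sym by (rule proj_psd_on_eq) (use A B in auto)
  have on0: "proj_psd_on I A = proj_psd A"
    using A by (rule proj_psd_on_eq)
  have dd1: "dd1_on I A B = M"
    unfolding dd1_on_def on on0 by (rule tendsto_Lim[OF _ M]) simp
  show "((\<lambda>t. (proj_psd (A + t *\<^sub>R B) - proj_psd A) /\<^sub>R t) \<longlongrightarrow> dd1_on I A B) (at_right 0)"
    using M by (simp add: dd1)
  let ?q = "\<lambda>t. (proj_psd (A + t *\<^sub>R B) - proj_psd A) /\<^sub>R t"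
  have "transpose (?q t) = ?q t" for t
    by (simp add: transpose_linear_simps psd_on_UNIV_transpose[OF proj_psd_in])
  with tendsto_transpose[OF M] have "(?q \<longlongrightarrow> transpose M) (at_right 0)" by (simp only:)
  then show "transpose (dd1_on I A B) = dd1_on I A B"
    unfolding dd1 using M by (rule tendsto_unique[rotated]) simp
  have "blk (?q t) I I = ?q t" for t
    using psd_on_blk[OF proj_psd_in, of I "A + t *\<^sub>R B"] psd_on_blk[OF proj_psd_in, of I A]
    by (simp add: blk_linear_simps on on0)
  with tendsto_blk[OF M, of I I] have "(?q \<longlongrightarrow> blk M I I) (at_right 0)" by (simp only:)
  then show "blk (dd1_on I A B) I I = dd1_on I A B"
    unfolding dd1 using M by (rule tendsto_unique[rotated]) simp
qed

text \<open>Every index \<open>k\<close> lies in the class of exactly one eigenvalue, so a sum over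
  distinct eigenvalues of block products becomes a single sum over the inner index
  \<open>k\<close>.\<close>

lemma sum_blocks_nth:
  fixes H Z :: "real^'n^'n"
  assumes "finite \<Omega>"
  shows "(\<Sum>c\<in>\<Omega>. f c *\<^sub>R (blk H I (alpha Z c) ** blk H (alpha Z c) J)) $ i $ j =
    (if i \<in> I \<and> j \<in> J
     then (\<Sum>k\<in>UNIV. if Z $ k $ k \<in> \<Omega> then f (Z $ k $ k) * (H $ i $ k * H $ k $ j) else 0) else 0)"
proof -
  have "(\<Sum>c\<in>\<Omega>. f c *\<^sub>R (blk H I (alpha Z c) ** blk H (alpha Z c) J)) $ i $ j =
     (\<Sum>c\<in>\<Omega>. \<Sum>k\<in>UNIV. f c * (blk H I (alpha Z c) $ i $ k * blk H (alpha Z c) J $ k $ j))"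
    by (simp add: matrix_matrix_mult_def sum_distrib_left)
  also have "\<dots> = (\<Sum>k\<in>UNIV. \<Sum>c\<in>\<Omega>. f c * (blk H I (alpha Z c) $ i $ k * blk H (alpha Z c) J $ k $ j))"
    by (rule sum.swap)
  also have "\<dots> = (\<Sum>k\<in>UNIV. \<Sum>c\<in>\<Omega>. if c = Z $ k $ k then
      (if i \<in> I \<and> j \<in> J then f (Z $ k $ k) * (H $ i $ k * H $ k $ j) else 0) else 0)"
    by (intro sum.cong refl) (auto simp: blk_def alpha_def)
  also have "\<dots> = (\<Sum>k\<in>UNIV. if Z $ k $ k \<in> \<Omega> then
      (if i \<in> I \<and> j \<in> J then f (Z $ k $ k) * (H $ i $ k * H $ k $ j) else 0) else 0)"
    using assms by (simp add: sum.delta)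
  also have "\<dots> = (if i \<in> I \<and> j \<in> J
     then (\<Sum>k\<in>UNIV. if Z $ k $ k \<in> \<Omega> then f (Z $ k $ k) * (H $ i $ k * H $ k $ j) else 0) else 0)"
    by (cases "i \<in> I \<and> j \<in> J") (auto intro!: sum.neutral cong: if_cong)
  finally show ?thesis .
qed

lemma finite_Omega: "finite (Omega_pos Z)" "finite (Omega_neg Z)"
  by (auto simp: Omega_pos_def Omega_neg_def)

lemma Omega_mem: "Z $ k $ k \<in> Omega_pos Z \<longleftrightarrow> 0 < Z $ k $ k" "Z $ k $ k \<in> Omega_neg Z \<longleftrightarrow> Z $ k $ k < 0"
  by (auto simp: Omega_pos_def Omega_neg_def)

section \<open>The limit of the second-order quotient\<close>

context diag_perturbation
begin

text \<open>The matrix V_0 of the theorem; \<open>V0_eq\<close> gives its explicit form. The factor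
  2 reflects the W/2 inside \<open>B\<close>.\<close>

definition V0 where "V0 = 2 *\<^sub>R blk B I0 I0"
definition T where "T = dd1_on I0 (blk H I0 I0) V0"
text \<open>Twice the order-t^2 coefficient of \<open>expand2_proj_X\<close>, since the quotient
  divides by t^2/2. The derivative \<open>T\<close> appears without the factor 2 because
  \<open>E t\<close> moves in direction \<open>V0\<close> with speed 1/2.\<close>

definition M where
  "M = 2 *\<^sub>R (blk B Ip Ip + K ** D1p - D1p ** K - K ** blk Z Ip Ip ** K
         + L ** blk Z Ip Ip + blk Z Ip Ip ** L') + T"

lemma transpose_V0: "transpose V0 = V0"
  by (simp add: V0_def transpose_linear_simps transpose_blk transpose_B)

lemma dd1_V0:
  shows "((\<lambda>t. (proj_psd (blk H I0 I0 + t *\<^sub>R V0) - proj_psd (blk H I0 I0)) /\<^sub>R t) \<longlongrightarrow> T) (at_right 0)"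
    and transpose_T: "transpose T = T"
    and blk_T: "blk T I0 I0 = T"
  unfolding T_def
  by (rule dd1_on_tendsto; simp add: transpose_blk symH transpose_V0; auto simp: V0_def blk_nth)+

lemma tendsto_proj_E_quotient:
  "((\<lambda>t. (proj_psd (E t) - proj_psd (blk H I0 I0)) /\<^sub>R t) \<longlongrightarrow> (1/2) *\<^sub>R T) (at_right 0)"
proof -
  \<comment> \<open>\<open>E t\<close> is \<open>blk H I0 I0 + (t/2) *\<^sub>R V0\<close>, so the
    limit is that of \<open>dd1_V0\<close> reparametrized by t/2.\<close>
  have "((\<lambda>t::real. t / 2) \<longlongrightarrow> 0) (at_right 0)"
    by (rule tendsto_eq_intros tendsto_id_at_right_0 refl | simp)+
  then have "filterlim (\<lambda>t::real. t / 2) (at_right 0) (at_right 0)"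
    unfolding filterlim_at using eventually_at_right_0_pos by (auto elim: eventually_mono)
  from tendsto_scaleR[OF tendsto_const filterlim_compose[OF dd1_V0(1) this], of "1/2"]
  have "((\<lambda>t. (1/2) *\<^sub>R ((proj_psd (blk H I0 I0 + (t/2) *\<^sub>R V0) - proj_psd (blk H I0 I0)) /\<^sub>R (t/2))) \<longlongrightarrow> (1/2) *\<^sub>R T) (at_right 0)" .
  moreover have "E t = blk H I0 I0 + (t/2) *\<^sub>R V0" for t by (simp add: E_def V0_def)
  ultimately show ?thesis by (simp add: inverse_eq_divide)
qed

lemma dd1_Z: "dd1_on UNIV Z H = D1p + K ** blk Z Ip Ip - blk Z Ip Ip ** K"
proof -
  \<comment> \<open>The instance with \<open>W = 0\<close> turns \<open>X\<close> into a straight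
    line; \<open>K\<close> and \<open>D1p\<close> depend only on \<open>Z\<close> and
    \<open>H\<close>, so its formula is the same.\<close>
  interpret Z0: diag_perturbation Z H 0
    by unfold_locales (simp_all add: diagZ symH transpose_linear_simps)
  show ?thesis
    unfolding dd1_on_def by (rule tendsto_Lim) (use Z0.has_dd1_X in \<open>simp_all add: Z0.X_def\<close>)
qed

lemma dd2_quot_tendsto: "(dd2_quot Z H W \<longlongrightarrow> M) (at_right 0)"
proof -
  let ?P1 = "D1p + K ** blk Z Ip Ip - blk Z Ip Ip ** K"
  have "(1/2) *\<^sub>R M = blk B Ip Ip + (1/2) *\<^sub>R T + K ** D1p - D1p ** K - K ** blk Z Ip Ip ** K
      + L ** blk Z Ip Ip + blk Z Ip Ip ** L'"
    by (simp add: M_def algebra_simps)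
  with expand2_proj_X[OF tendsto_proj_E_quotient]
  have e: "expand2 (\<lambda>t. proj_psd (X t)) (blk Z Ip Ip) ?P1 ((1/2) *\<^sub>R M)"
    by (simp only:)
  \<comment> \<open>Doubling the scaled remainder and adding \<open>M\<close> back is, for t > 0,
    exactly \<open>dd2_quot\<close>.\<close>
  have lim: "((\<lambda>t. 2 *\<^sub>R ((proj_psd (X t) - blk Z Ip Ip - t *\<^sub>R ?P1 - t\<^sup>2 *\<^sub>R ((1/2) *\<^sub>R M)) /\<^sub>R t\<^sup>2) + M) \<longlongrightarrow> 2 *\<^sub>R 0 + M) (at_right 0)"
    by (intro tendsto_intros e[unfolded expand2_def])
  show ?thesis
  proof (rule Lim_transform_eventually[OF lim[simplified scaleR_zero_right add_0_left]])
    show "eventually (\<lambda>t. 2 *\<^sub>R ((proj_psd (X t) - blk Z Ip Ip - t *\<^sub>R ?P1 - t\<^sup>2 *\<^sub>R ((1/2) *\<^sub>R M)) /\<^sub>R t\<^sup>2) + M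
        = dd2_quot Z H W t) (at_right 0)"
      using eventually_at_right_0_pos
    proof eventually_elim
      case (elim t)
      have "2 *\<^sub>R ((Y - t\<^sup>2 *\<^sub>R ((1/2) *\<^sub>R N)) /\<^sub>R t\<^sup>2) + N = Y /\<^sub>R (t\<^sup>2 / 2)" for Y N :: "real^'n^'n"
      proof -
        have "2 * (inverse (t\<^sup>2) * (t\<^sup>2 * (1/2))) = 1" "inverse (t\<^sup>2 / 2) = 2 * inverse (t\<^sup>2)"
          using elim by (simp_all add: field_simps)
        then show ?thesis
          by (simp only: scaleR_diff_right scaleR_scaleR mult.assoc scaleR_one diff_add_cancel)
      qed
      then show ?case
        by (simp only: dd2_quot_def X_def proj_Z dd1_Z)
    qed
  qed
qed

lemma transpose_D1p: "transpose D1p = D1p"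
  by (simp add: D1p_def transpose_linear_simps transpose_blk symH psd_on_UNIV_transpose[OF proj_psd_in])

lemma transpose_M: "transpose M = M"
proof -
  have "transpose L' = L" using transpose_L by (metis transpose_transpose)
  then show ?thesis
    by (simp add: M_def transpose_linear_simps transpose_blk transpose_B transpose_K transpose_D1p transpose_T
      transpose_L symZ matrix_transpose_mul matrix_mult_bilinear_simps matrix_mul_assoc)
qed

end

subsection \<open>Entries and blocks of the second derivative\<close>

context diag_perturbation
begin

abbreviation zp :: "'n \<Rightarrow> real" where "zp i \<equiv> max 0 (z i)"

text \<open>The divided difference of the function max 0 at \<open>z i\<close> and
  \<open>z j\<close>, extended by 1, 0, 0 to pairs inside the positive, zero and negative class. The
  value 0 for the zero class is right because that part of \<open>B\<close> acts through
  \<open>T\<close>.\<close>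

definition \<theta> where
  "\<theta> i j = (if sgn (z i) = sgn (z j) then if 0 < z i then 1 else 0 else (zp j - zp i) / (z j - z i))"

text \<open>Contribution of the intermediate index \<open>k\<close> to entry (i, j) of
  \<open>M\<close>, beyond \<open>T\<close> and the \<open>W\<close> term; the bracket weighted by
  \<open>\<theta>\<close> is the summand of \<open>B_nth\<close>.\<close>

definition \<gamma> where
  "\<gamma> i j k = 2 * (\<theta> i j * (K $ i $ k * K $ k $ j * (z k - (z i + z j) / 2)
        - K $ i $ k * same H $ k $ j + same H $ i $ k * K $ k $ j)
      + K $ i $ k * D1p $ k $ j - D1p $ i $ k * K $ k $ j
      + K $ i $ k * K $ k $ j * ((zp i + zp j) / 2 - zp k))"

lemma blk_Z_pos: "diag_mat (blk Z Ip Ip)" "blk Z Ip Ip $ i $ i = zp i"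
  using diagZ by (auto simp: diag_mat_def blk_def)

lemma B_nth:
  "B $ i $ j = W $ i $ j / 2 + (\<Sum>k\<in>UNIV. K $ i $ k * K $ k $ j * (z k - (z i + z j) / 2)
        - K $ i $ k * same H $ k $ j + same H $ i $ k * K $ k $ j)"
proof -
  have "K ** Z ** K = K ** (Z ** K)" by (simp add: matrix_mul_assoc)
  then have KZK: "(K ** Z ** K) $ i $ j = (\<Sum>k\<in>UNIV. K $ i $ k * (z k * K $ k $ j))"
    by (simp add: matrix_matrix_mult_def[of K "Z ** K"] diag_mat_mult_nth[OF diagZ])
  have KKZ: "(K ** K ** Z) $ i $ j = (\<Sum>k\<in>UNIV. K $ i $ k * K $ k $ j) * z j"
    by (simp only: diag_mat_mult_nth[OF diagZ]) (simp add: matrix_matrix_mult_def)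
  have "Z ** K ** K = Z ** (K ** K)" by (simp add: matrix_mul_assoc)
  then have ZKK: "(Z ** K ** K) $ i $ j = z i * (\<Sum>k\<in>UNIV. K $ i $ k * K $ k $ j)"
    by (simp only: diag_mat_mult_nth[OF diagZ]) (simp add: matrix_matrix_mult_def)
  have "B $ i $ j = W $ i $ j / 2 - ((K ** same H) $ i $ j - (same H ** K) $ i $ j)
      + (K ** Z ** K) $ i $ j - ((K ** K ** Z) $ i $ j + (Z ** K ** K) $ i $ j) / 2"
    by (simp add: B_def)
  also have "\<dots> = W $ i $ j / 2 + (\<Sum>k\<in>UNIV. K $ i $ k * K $ k $ j * (z k - (z i + z j) / 2)
        - K $ i $ k * same H $ k $ j + same H $ i $ k * K $ k $ j)"
    unfolding KZK KKZ ZKK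
    by (simp add: matrix_matrix_mult_def sum.distrib sum_subtractf sum_distrib_left sum_distrib_right
        sum_divide_distrib algebra_simps add_divide_distrib)
  finally show ?thesis .
qed

lemma M_nth: "M $ i $ j = T $ i $ j + \<theta> i j * W $ i $ j + (\<Sum>k\<in>UNIV. \<gamma> i j k)"
proof -
  let ?P = "blk Z Ip Ip"
  have "K ** ?P ** K = K ** (?P ** K)" by (simp add: matrix_mul_assoc)
  then have KPK: "(K ** ?P ** K) $ i $ j = (\<Sum>k\<in>UNIV. K $ i $ k * (zp k * K $ k $ j))"
    by (simp add: matrix_matrix_mult_def[of K "?P ** K"] diag_mat_mult_nth[OF blk_Z_pos(1)] blk_Z_pos(2))
  have KK: "(K ** K) $ i $ j = (\<Sum>k\<in>UNIV. K $ i $ k * K $ k $ j)"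
    by (simp add: matrix_matrix_mult_def)
  \<comment> \<open>\<open>B\<close> enters \<open>M\<close> through its positive block and through
    \<open>cross B\<close> in \<open>L\<close> and \<open>L'\<close>; together these weight each
    entry by \<open>\<theta>\<close>.\<close>
  have "blk B Ip Ip $ i $ j + cross B $ i $ j * zp j - zp i * cross B $ i $ j = \<theta> i j * B $ i $ j"
    by (auto simp: blk_def cross_def \<theta>_def sgn_if diff_divide_distrib algebra_simps split: if_splits)
  then have "M $ i $ j = T $ i $ j + 2 * (\<theta> i j * B $ i $ j + (K ** D1p) $ i $ j - (D1p ** K) $ i $ j
      - (K ** ?P ** K) $ i $ j + (zp i + zp j) / 2 * (K ** K) $ i $ j)"
    by (simp add: M_def L_def L'_def diag_mat_mult_nth[OF blk_Z_pos(1)] blk_Z_pos(2) algebra_simps add_divide_distrib)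
  also have "\<dots> = T $ i $ j + \<theta> i j * W $ i $ j + (\<Sum>k\<in>UNIV. \<gamma> i j k)"
    unfolding KPK KK B_nth \<gamma>_def
    by (simp add: matrix_matrix_mult_def sum.distrib sum_subtractf sum_distrib_left
        algebra_simps add_divide_distrib)
  finally show ?thesis .
qed

lemma K_nth: "K $ i $ j = (if sgn (z i) = sgn (z j) then 0 else H $ i $ j / (z j - z i))"
  by (simp add: K_def cross_def)

lemma T_nth: "z i \<noteq> 0 \<or> z j \<noteq> 0 \<Longrightarrow> T $ i $ j = 0"
  using arg_cong[OF blk_T, of "\<lambda>A. A $ i $ j"] by (auto simp: blk_nth)

lemma proj_H0_nth: "z i \<noteq> 0 \<or> z j \<noteq> 0 \<Longrightarrow> proj_psd (blk H I0 I0) $ i $ j = 0"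
proof -
  have "proj_psd (blk H I0 I0) = proj_psd_on I0 (blk H I0 I0)"
    by (rule proj_psd_on_eq[symmetric]) (auto simp: transpose_blk symH blk_nth)
  moreover assume "z i \<noteq> 0 \<or> z j \<noteq> 0"
  ultimately show ?thesis using proj_psd_in[of I0 "blk H I0 I0"] by (auto simp: psd_on_def)
qed

lemma D1p_nth: "D1p $ i $ j = (if 0 < z i \<and> 0 < z j then H $ i $ j else proj_psd (blk H I0 I0) $ i $ j)"
  by (auto simp: D1p_def blk_nth proj_H0_nth)

section \<open>Entries of \<open>M\<close> by the signs of the two eigenvalues\<close>

lemmas entry_simps = \<gamma>_def \<theta>_def K_nth D1p_nth same_def proj_H0_nth

text \<open>For fixed signs of \<open>z i\<close> and \<open>z j\<close>, the sign of
  \<open>z k\<close> decides which of \<open>K\<close>, \<open>same H\<close> and \<open>D1p\<close>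
  vanish in \<open>\<gamma>\<close>; the rest is a rational identity. The other sign patterns are
  handled alike.\<close>

lemma M_pos_pos:
  assumes "0 < z i" "0 < z j"
  shows "M $ i $ j = W $ i $ j +
    (\<Sum>k\<in>UNIV. if z k < 0 then 2 * (- z k) / ((z k - z i) * (z k - z j)) * (H $ i $ k * H $ k $ j) else 0)"
proof -
  have "\<gamma> i j k = (if z k < 0 then 2 * (- z k) / ((z k - z i) * (z k - z j)) * (H $ i $ k * H $ k $ j) else 0)" for k
    using assms by (cases "z k" "0::real" rule: linorder_cases) (simp_all add: entry_simps divide_simps, (simp_all add: algebra_simps)?)
  then show ?thesis using assms by (simp add: M_nth T_nth \<theta>_def)
qed

lemma M_neg_neg:
  assumes "z i < 0" "z j < 0"
  shows "M $ i $ j =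
    (\<Sum>k\<in>UNIV. if z k > 0 then 2 * z k / ((z k - z i) * (z k - z j)) * (H $ i $ k * H $ k $ j) else 0)"
proof -
  have "\<gamma> i j k = (if z k > 0 then 2 * z k / ((z k - z i) * (z k - z j)) * (H $ i $ k * H $ k $ j) else 0)" for k
    using assms by (cases "z k" "0::real" rule: linorder_cases) (simp_all add: entry_simps divide_simps, (simp_all add: algebra_simps)?)
  then show ?thesis using assms by (simp add: M_nth T_nth \<theta>_def)
qed

text \<open>For \<open>k\<close> in the zero class, \<open>D1p\<close> supplies Pi_+(H_00) and the
  \<open>\<theta>\<close>-weighted part supplies - H_00; their sum is Pi_+(- H_00) by
  \<open>proj_psd_uminus\<close>.\<close>

lemma M_pos_zero:
  assumes "0 < z i" "z j = 0"
  shows "M $ i $ j = W $ i $ j +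
    (\<Sum>k\<in>UNIV. if z k < 0 then 2 / (z i - z k) * (H $ i $ k * H $ k $ j) else 0)
    - 2 / z i * (\<Sum>k\<in>UNIV. if z k = 0 then H $ i $ k * (proj_psd (blk H I0 I0) $ k $ j - H $ k $ j) else 0)"
proof -
  have "\<gamma> i j k = (if z k < 0 then 2 / (z i - z k) * (H $ i $ k * H $ k $ j) else 0)
     - 2 / z i * (if z k = 0 then H $ i $ k * (proj_psd (blk H I0 I0) $ k $ j - H $ k $ j) else 0)" for k
    using assms by (cases "z k" "0::real" rule: linorder_cases) (simp_all add: entry_simps divide_simps, (simp_all add: algebra_simps)?)
  then show ?thesis using assms
    by (simp add: M_nth T_nth \<theta>_def sum_subtractf sum_distrib_left)
qed

text \<open>Here \<open>\<theta>\<close> is 0, so \<open>W\<close> drops out, and a \<open>k\<close>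
  in the zero class contributes only through \<open>D1p\<close>.\<close>

lemma M_zero_neg:
  assumes "z i = 0" "z j < 0"
  shows "M $ i $ j =
    (\<Sum>k\<in>UNIV. if z k > 0 then 2 / (z k - z j) * (H $ i $ k * H $ k $ j) else 0)
    + 2 / (- z j) * (\<Sum>k\<in>UNIV. if z k = 0 then proj_psd (blk H I0 I0) $ i $ k * H $ k $ j else 0)"
proof -
  have "\<gamma> i j k = (if z k > 0 then 2 / (z k - z j) * (H $ i $ k * H $ k $ j) else 0)
     + 2 / (- z j) * (if z k = 0 then proj_psd (blk H I0 I0) $ i $ k * H $ k $ j else 0)" for k
    using assms by (cases "z k" "0::real" rule: linorder_cases) (simp_all add: entry_simps divide_simps, (simp_all add: algebra_simps)?)
  then show ?thesis using assms
    by (simp add: M_nth T_nth \<theta>_def sum_subtractf sum_negf sum_distrib_left)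
qed

text \<open>Again \<open>\<theta>\<close> is 0; indices with negative \<open>z k\<close> contribute
  nothing explicitly and act only through \<open>V0\<close> inside \<open>T\<close>.\<close>

lemma M_zero_zero:
  assumes "z i = 0" "z j = 0"
  shows "M $ i $ j = (\<Sum>k\<in>UNIV. if z k > 0 then 2 / z k * (H $ i $ k * H $ k $ j) else 0) + T $ i $ j"
proof -
  have "\<gamma> i j k = (if z k > 0 then 2 / z k * (H $ i $ k * H $ k $ j) else 0)" for k
    using assms by (cases "z k" "0::real" rule: linorder_cases) (simp_all add: entry_simps divide_simps, (simp_all add: algebra_simps)?)
  then show ?thesis using assms by (simp add: M_nth \<theta>_def)
qed

lemma M_pos_neg:
  assumes "0 < z i" "z j < 0"
  shows "M $ i $ j = z i / (z i - z j) * W $ i $ j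
    + (\<Sum>k\<in>UNIV. if z k > 0 then 2 * (- z j) / ((z j - z i) * (z j - z k)) * (H $ i $ k * H $ k $ j) else 0)
    + 2 / (z i - z j) * (\<Sum>k\<in>UNIV. if z k = 0 then H $ i $ k * H $ k $ j else 0)
    + (\<Sum>k\<in>UNIV. if z k < 0 then 2 * z i / ((z i - z j) * (z i - z k)) * (H $ i $ k * H $ k $ j) else 0)"
proof -
  have "\<gamma> i j k = (if z k > 0 then 2 * (- z j) / ((z j - z i) * (z j - z k)) * (H $ i $ k * H $ k $ j) else 0)
    + 2 / (z i - z j) * (if z k = 0 then H $ i $ k * H $ k $ j else 0)
    + (if z k < 0 then 2 * z i / ((z i - z j) * (z i - z k)) * (H $ i $ k * H $ k $ j) else 0)" for k
    using assms by (cases "z k" "0::real" rule: linorder_cases) (simp_all add: entry_simps divide_simps, (simp_all add: algebra_simps)?)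
  moreover have "\<theta> i j = z i / (z i - z j)"
    using assms by (simp add: \<theta>_def field_simps)
  ultimately show ?thesis using assms
    by (simp add: M_nth T_nth sum.distrib sum_distrib_left)
qed

text \<open>Inside the zero block each product of an entry of \<open>K\<close> with one of
  \<open>same H\<close> vanishes, and \<open>K $ i $ k * K $ k $ j * z k\<close> is - H_ik H_kj /
  z_k whenever \<open>z k\<close> is nonzero, whatever its sign.\<close>

lemma V0_eq: "V0 = blk W I0 I0 - (\<Sum>l\<in>Omega_pos Z \<union> Omega_neg Z.
   (2 / l) *\<^sub>R (blk H I0 (alpha Z l) ** blk H (alpha Z l) I0))"
  unfolding vec_eq_iff
proof safe
  fix i j
  show "V0 $ i $ j = (blk W I0 I0 - (\<Sum>l\<in>Omega_pos Z \<union> Omega_neg Z.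
   (2 / l) *\<^sub>R (blk H I0 (alpha Z l) ** blk H (alpha Z l) I0))) $ i $ j"
  proof (cases "z i = 0 \<and> z j = 0")
    case True
    have "2 * (K $ i $ k * K $ k $ j * (z k - (z i + z j) / 2)
        - K $ i $ k * same H $ k $ j + same H $ i $ k * K $ k $ j) =
        - (if z k \<in> Omega_pos Z \<union> Omega_neg Z then 2 / z k * (H $ i $ k * H $ k $ j) else 0)" for k
      using True by (cases "z k" "0::real" rule: linorder_cases) (simp_all add: K_nth same_def Omega_mem divide_simps)
    then show ?thesis
      using True by (simp only: vector_minus_component sum_blocks_nth finite_Omega finite_UnI V0_def B_nth
         vector_scaleR_component blk_nth) (simp add: distrib_left sum_distrib_left sum_negf)
  next
    case False
    then show ?thesis by (simp only: vector_minus_component sum_blocks_nth finite_Omega finite_UnI V0_def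
         vector_scaleR_component blk_nth) auto
  qed
qed

section \<open>From entries to blocks\<close>

lemma alpha_0: "alpha Z 0 = I0"
  by (simp add: alpha_def)

lemma proj_psd_on_H0:
  "proj_psd_on I0 (blk H I0 I0) = proj_psd (blk H I0 I0)"
  "proj_psd_on I0 (- blk H I0 I0) = proj_psd (blk H I0 I0) - blk H I0 I0"
proof -
  have sym: "transpose (blk H I0 I0) = blk H I0 I0"
    by (simp add: transpose_blk symH)
  show "proj_psd_on I0 (blk H I0 I0) = proj_psd (blk H I0 I0)"
    using sym by (rule proj_psd_on_eq) (auto simp: blk_nth)
  have "proj_psd_on I0 (- blk H I0 I0) = proj_psd (- blk H I0 I0)"
    by (rule proj_psd_on_eq) (auto simp: blk_nth transpose_linear_simps sym)
  then show "proj_psd_on I0 (- blk H I0 I0) = proj_psd (blk H I0 I0) - blk H I0 I0"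
    by (simp add: proj_psd_uminus[OF sym])
qed

lemmas block_entry_simps =
  vector_add_component vector_minus_component vector_scaleR_component blk_nth
  sum_blocks_nth[OF finite_Omega(1)] sum_blocks_nth[OF finite_Omega(2)]

lemma block_pos_pos:
  assumes "a \<in> Omega_pos Z" "b \<in> Omega_pos Z"
  shows "blk M (alpha Z a) (alpha Z b) = blk W (alpha Z a) (alpha Z b)
    + (\<Sum>c\<in>Omega_neg Z. (2 * (- c) / ((c - a) * (c - b))) *\<^sub>R
        (blk H (alpha Z a) (alpha Z c) ** blk H (alpha Z c) (alpha Z b)))" (is "?l = ?r")
proof -
  have "?l $ i $ j = ?r $ i $ j" for i j
  proof (cases "i \<in> alpha Z a \<and> j \<in> alpha Z b")
    case True
    then have "z i = a" "z j = b" by (auto simp: alpha_def)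
    with assms True M_pos_pos[of i j] show ?thesis
      unfolding block_entry_simps by (auto simp: Omega_mem cong: if_cong)
  next
    case False
    then show ?thesis unfolding block_entry_simps by auto
  qed
  then show ?thesis by (simp add: vec_eq_iff)
qed

lemma block_neg_neg:
  assumes "a \<in> Omega_neg Z" "b \<in> Omega_neg Z"
  shows "blk M (alpha Z a) (alpha Z b) =
    (\<Sum>c\<in>Omega_pos Z. (2 * c / ((c - a) * (c - b))) *\<^sub>R
        (blk H (alpha Z a) (alpha Z c) ** blk H (alpha Z c) (alpha Z b)))" (is "?l = ?r")
proof -
  have "?l $ i $ j = ?r $ i $ j" for i j
  proof (cases "i \<in> alpha Z a \<and> j \<in> alpha Z b")
    case True
    then have "z i = a" "z j = b" by (auto simp: alpha_def)
    with assms True M_neg_neg[of i j] show ?thesis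
      unfolding block_entry_simps by (auto simp: Omega_mem cong: if_cong)
  next
    case False
    then show ?thesis unfolding block_entry_simps by auto
  qed
  then show ?thesis by (simp add: vec_eq_iff)
qed

lemma block_pos_zero:
  assumes "a \<in> Omega_pos Z"
  shows "blk M (alpha Z a) I0 = blk W (alpha Z a) I0
    + (\<Sum>c\<in>Omega_neg Z. (2 / (a - c)) *\<^sub>R (blk H (alpha Z a) (alpha Z c) ** blk H (alpha Z c) I0))
    - (2 / a) *\<^sub>R (blk H (alpha Z a) I0 ** proj_psd_on I0 (- blk H I0 I0))" (is "?l = ?r")
proof -
  \<comment> \<open>By \<open>proj_psd_on_H0\<close> this is Pi_+(- H_00), supported on the zero
    class.\<close>
  let ?N = "proj_psd (blk H I0 I0) - blk H I0 I0"
  have "(blk H (alpha Z a) I0 ** ?N) $ i $ j =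
     (if i \<in> alpha Z a \<and> j \<in> I0
      then \<Sum>k\<in>UNIV. if z k = 0 then H $ i $ k * (proj_psd (blk H I0 I0) $ k $ j - H $ k $ j) else 0 else 0)" for i j
    unfolding matrix_matrix_mult_def vec_lambda_beta
    by (auto intro!: sum.cong sum.neutral simp: blk_nth proj_H0_nth)
  note prod = this
  have "?l $ i $ j = ?r $ i $ j" for i j
  proof (cases "i \<in> alpha Z a \<and> j \<in> I0")
    case True
    then have "z i = a" "z j = 0" by (auto simp: alpha_def)
    with assms True M_pos_zero[of i j] show ?thesis
      unfolding block_entry_simps prod proj_psd_on_H0 by (auto simp: Omega_mem cong: if_cong)
  next
    case False
    then show ?thesis unfolding block_entry_simps prod proj_psd_on_H0 by auto
  qed
  then show ?thesis by (simp add: vec_eq_iff)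
qed

lemma block_zero_neg:
  assumes "b \<in> Omega_neg Z"
  shows "blk M I0 (alpha Z b) =
    (\<Sum>c\<in>Omega_pos Z. (2 / (c - b)) *\<^sub>R (blk H I0 (alpha Z c) ** blk H (alpha Z c) (alpha Z b)))
    + (2 / (- b)) *\<^sub>R (proj_psd_on I0 (blk H I0 I0) ** blk H I0 (alpha Z b))" (is "?l = ?r")
proof -
  have "(proj_psd (blk H I0 I0) ** blk H I0 (alpha Z b)) $ i $ j =
     (if i \<in> I0 \<and> j \<in> alpha Z b
      then \<Sum>k\<in>UNIV. if z k = 0 then proj_psd (blk H I0 I0) $ i $ k * H $ k $ j else 0 else 0)" for i j
    unfolding matrix_matrix_mult_def vec_lambda_beta
    by (auto intro!: sum.cong sum.neutral simp: blk_nth proj_H0_nth)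
  note prod = this
  have "?l $ i $ j = ?r $ i $ j" for i j
  proof (cases "i \<in> I0 \<and> j \<in> alpha Z b")
    case True
    then have "z i = 0" "z j = b" by (auto simp: alpha_def)
    with assms True M_zero_neg[of i j] show ?thesis
      unfolding block_entry_simps prod proj_psd_on_H0 by (auto simp: Omega_mem cong: if_cong)
  next
    case False
    then show ?thesis unfolding block_entry_simps prod proj_psd_on_H0 by auto
  qed
  then show ?thesis by (simp add: vec_eq_iff)
qed

lemma block_zero_zero:
  "blk M I0 I0 =
    (\<Sum>c\<in>Omega_pos Z. (2 / c) *\<^sub>R (blk H I0 (alpha Z c) ** blk H (alpha Z c) I0)) + T" (is "?l = ?r")
proof -
  have "?l $ i $ j = ?r $ i $ j" for i j
  proof (cases "i \<in> I0 \<and> j \<in> I0")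
    case True
    with M_zero_zero[of i j] show ?thesis
      unfolding block_entry_simps by (auto simp: Omega_mem cong: if_cong)
  next
    case False
    then show ?thesis unfolding block_entry_simps by (auto simp: T_nth)
  qed
  then show ?thesis by (simp add: vec_eq_iff)
qed

lemma block_pos_neg:
  assumes "a \<in> Omega_pos Z" "b \<in> Omega_neg Z"
  shows "blk M (alpha Z a) (alpha Z b) = (a / (a - b)) *\<^sub>R blk W (alpha Z a) (alpha Z b)
    + (\<Sum>c\<in>Omega_pos Z. (2 * (- b) / ((b - a) * (b - c))) *\<^sub>R
        (blk H (alpha Z a) (alpha Z c) ** blk H (alpha Z c) (alpha Z b)))
    + (2 / (a - b)) *\<^sub>R (blk H (alpha Z a) I0 ** blk H I0 (alpha Z b))
    + (\<Sum>c\<in>Omega_neg Z. (2 * a / ((a - b) * (a - c))) *\<^sub>R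
        (blk H (alpha Z a) (alpha Z c) ** blk H (alpha Z c) (alpha Z b)))" (is "?l = ?r")
proof -
  have "(blk H (alpha Z a) I0 ** blk H I0 (alpha Z b)) $ i $ j =
     (if i \<in> alpha Z a \<and> j \<in> alpha Z b
      then \<Sum>k\<in>UNIV. if z k = 0 then H $ i $ k * H $ k $ j else 0 else 0)" for i j
    unfolding matrix_matrix_mult_def vec_lambda_beta
    by (auto intro!: sum.cong sum.neutral simp: blk_nth)
  note prod = this
  have "?l $ i $ j = ?r $ i $ j" for i j
  proof (cases "i \<in> alpha Z a \<and> j \<in> alpha Z b")
    case True
    then have "z i = a" "z j = b" by (auto simp: alpha_def)
    with assms True M_pos_neg[of i j] show ?thesis
      unfolding block_entry_simps prod by (auto simp: Omega_mem cong: if_cong)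
  next
    case False
    then show ?thesis unfolding block_entry_simps prod by auto
  qed
  then show ?thesis by (simp add: vec_eq_iff)
qed

end

section \<open>Equivariance under orthogonal conjugation\<close>

lemma dd2_quot_orthogonal_conj:
  fixes Z Q :: "real^'n^'n"
  assumes Q: "orthogonal_matrix Q"
    and sym: "transpose Z = Z" "transpose H = H" "transpose W = W"
  defines "Z' \<equiv> transpose Q ** Z ** Q" and "H' \<equiv> transpose Q ** H ** Q" and "W' \<equiv> transpose Q ** W ** Q"
  shows "dd2_quot Z H W t = Q ** dd2_quot Z' H' W' t ** transpose Q"
proof -
  have sym': "transpose Z' = Z'" "transpose H' = H'" "transpose W' = W'"
    by (simp_all add: Z'_def H'_def W'_def matrix_transpose_mul sym matrix_mul_assoc)
  have ZHW: "Z = Q ** Z' ** transpose Q" "H = Q ** H' ** transpose Q" "W = Q ** W' ** transpose Q"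
    by (simp_all add: Z'_def H'_def W'_def orthogonal_conj_cancel[OF Q])
  \<comment> \<open>Both parameters are kept free: \<open>r = 0\<close> gives the straight line that
    defines \<open>dd1_on\<close>, and \<open>s = r = 0\<close> the base point.\<close>
  have proj: "proj_psd (Z + s *\<^sub>R H + r *\<^sub>R W) = Q ** proj_psd (Z' + s *\<^sub>R H' + r *\<^sub>R W') ** transpose Q" for s r
  proof -
    have "Z + s *\<^sub>R H + r *\<^sub>R W = Q ** (Z' + s *\<^sub>R H' + r *\<^sub>R W') ** transpose Q"
      by (simp add: ZHW matrix_mult_bilinear_simps)
    then show ?thesis
      using sym' proj_psd_orthogonal_conj[OF _ Q, of "Z' + s *\<^sub>R H' + r *\<^sub>R W'"]
      by (simp add: transpose_linear_simps)
  qed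
  have proj1: "proj_psd (Z + s *\<^sub>R H) = Q ** proj_psd (Z' + s *\<^sub>R H') ** transpose Q" for s
    using proj[of s 0] by simp
  have proj0: "proj_psd Z = Q ** proj_psd Z' ** transpose Q"
    using proj[of 0 0] by simp
  \<comment> \<open>The first derivative is a \<open>Lim\<close>, so it is transferred through an
    existing limit, supplied by \<open>dd1_on_tendsto\<close>.\<close>
  have "((\<lambda>t. Q ** ((proj_psd (Z' + t *\<^sub>R H') - proj_psd Z') /\<^sub>R t) ** transpose Q) \<longlongrightarrow>
      Q ** dd1_on UNIV Z' H' ** transpose Q) (at_right 0)"
    by (intro tendsto_intros dd1_on_tendsto sym') auto
  moreover have "Q ** ((proj_psd (Z' + t *\<^sub>R H') - proj_psd Z') /\<^sub>R t) ** transpose Q =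
      (proj_psd (Z + t *\<^sub>R H) - proj_psd Z) /\<^sub>R t" for t
    unfolding proj1 proj0 by (simp add: matrix_mult_bilinear_simps)
  ultimately have "dd1_on UNIV Z H = Q ** dd1_on UNIV Z' H' ** transpose Q"
    unfolding dd1_on_def[of _ Z H] by (intro tendsto_Lim) simp_all
  then show ?thesis
    unfolding dd2_quot_def proj proj0 by (simp add: matrix_mult_bilinear_simps)
qed

theorem theorem3p2:
  shows
  "(\<forall>(Z::real^'n^'n) H W. sym_mat Z \<and> diag_mat Z \<and> sym_mat H \<and> sym_mat W \<longrightarrow>
     (let A = alpha Z; A0 = alpha Z 0; H00 = blk H A0 A0 in
     (\<exists>M. (dd2_quot Z H W \<longlongrightarrow> M) (at_right 0) \<and> transpose M = M \<and>
       (\<forall>a\<in>Omega_pos Z. \<forall>b\<in>Omega_pos Z.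
          blk M (A a) (A b) = blk W (A a) (A b)
            + (\<Sum>c\<in>Omega_neg Z. (2 * (- c) / ((c - a) * (c - b))) *\<^sub>R (blk H (A a) (A c) ** blk H (A c) (A b)))) \<and>
       ((\<exists>i. Z $ i $ i = 0) \<longrightarrow> (\<forall>a\<in>Omega_pos Z.
          blk M (A a) A0 = blk W (A a) A0
            + (\<Sum>c\<in>Omega_neg Z. (2 / (a - c)) *\<^sub>R (blk H (A a) (A c) ** blk H (A c) A0))
            - (2 / a) *\<^sub>R (blk H (A a) A0 ** proj_psd_on A0 (- H00)))) \<and>
       (\<forall>a\<in>Omega_pos Z. \<forall>b\<in>Omega_neg Z.
          blk M (A a) (A b) = (a / (a - b)) *\<^sub>R blk W (A a) (A b)
            + (\<Sum>c\<in>Omega_pos Z. (2 * (- b) / ((b - a) * (b - c))) *\<^sub>R (blk H (A a) (A c) ** blk H (A c) (A b)))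
            + (2 / (a - b)) *\<^sub>R (blk H (A a) A0 ** blk H A0 (A b))
            + (\<Sum>c\<in>Omega_neg Z. (2 * a / ((a - b) * (a - c))) *\<^sub>R (blk H (A a) (A c) ** blk H (A c) (A b)))) \<and>
       ((\<exists>i. Z $ i $ i = 0) \<longrightarrow>
          blk M A0 A0 = (\<Sum>c\<in>Omega_pos Z. (2 / c) *\<^sub>R (blk H A0 (A c) ** blk H (A c) A0))
            + dd1_on A0 H00
                (blk W A0 A0 - (\<Sum>l\<in>Omega_pos Z \<union> Omega_neg Z. (2 / l) *\<^sub>R (blk H A0 (A l) ** blk H (A l) A0)))) \<and>
       ((\<exists>i. Z $ i $ i = 0) \<longrightarrow> (\<forall>b\<in>Omega_neg Z.
          blk M A0 (A b) = (\<Sum>c\<in>Omega_pos Z. (2 / (c - b)) *\<^sub>R (blk H A0 (A c) ** blk H (A c) (A b)))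
            + (2 / (- b)) *\<^sub>R (proj_psd_on A0 H00 ** blk H A0 (A b)))) \<and>
       (\<forall>a\<in>Omega_neg Z. \<forall>b\<in>Omega_neg Z.
          blk M (A a) (A b) = (\<Sum>c\<in>Omega_pos Z. (2 * c / ((c - a) * (c - b))) *\<^sub>R (blk H (A a) (A c) ** blk H (A c) (A b)))))))
  \<and>
  (\<forall>(Z::real^'n^'n) Q H W. sym_mat Z \<and> sym_mat H \<and> sym_mat W \<and> orthogonal_matrix Q
       \<and> diag_mat (transpose Q ** Z ** Q) \<longrightarrow>
     (dd2_quot Z H W \<longlongrightarrow> Q ** dd2 (transpose Q ** Z ** Q) (transpose Q ** H ** Q) (transpose Q ** W ** Q) ** transpose Q) (at_right 0))"
proof (intro conjI allI impI, goal_cases)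
  case (1 Z H W)
  then interpret diag_perturbation Z H W
    by unfold_locales (simp_all add: sym_mat_def)
  \<comment> \<open>Folding \<open>V0_eq\<close> and \<open>T_def\<close> turns the derivative term
    of the zero block into \<open>T\<close>, so that the block lemmas apply as they stand.\<close>
  show ?case
    unfolding Let_def alpha_0 V0_eq[symmetric] T_def[symmetric]
    by (intro exI[of _ M] conjI ballI impI dd2_quot_tendsto transpose_M block_pos_pos block_pos_zero
      block_pos_neg block_zero_zero block_zero_neg block_neg_neg)
next
  case (2 Z Q H W)
  let ?Z = "transpose Q ** Z ** Q" and ?H = "transpose Q ** H ** Q" and ?W = "transpose Q ** W ** Q"
  interpret diag_perturbation ?Z ?H ?W
    by unfold_locales (use 2 in \<open>simp_all add: sym_mat_def matrix_transpose_mul matrix_mul_assoc\<close>)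
  \<comment> \<open>\<open>dd2\<close> is a \<open>Lim\<close>; at the diagonal conjugate it equals
    the established limit \<open>M\<close>. Since the quotients are conjugate at every t,
    convergence carries over to \<open>Z\<close>.\<close>
  have "dd2 ?Z ?H ?W = M"
    unfolding dd2_def using dd2_quot_tendsto by (intro tendsto_Lim) simp_all
  then have "((\<lambda>t. Q ** dd2_quot ?Z ?H ?W t ** transpose Q) \<longlongrightarrow> Q ** dd2 ?Z ?H ?W ** transpose Q) (at_right 0)"
    using dd2_quot_tendsto by (intro tendsto_intros) simp_all
  moreover have "dd2_quot Z H W = (\<lambda>t. Q ** dd2_quot ?Z ?H ?W t ** transpose Q)"
    using 2 by (intro ext dd2_quot_orthogonal_conj) (simp_all add: sym_mat_def)
  ultimately show ?case
    by simp
qed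

end
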